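(* Let $k\ge 1$, $n=4k$, let $j\ge 0$ be an integer which is odd if $k$ is even and even if $k$ is odd, and let $t$ be an odd integer. Let $\zeta$ be a primitive element of $\mathbb{F}_{3^{2k}}$. Then the function $f:\mathbb{F}_{3^n}\to\mathbb{F}_3$, $$f(x)=\mathrm{Tr}_n\big(x^{3^k+2}-x^{2\cdot 3^k+1}+\zeta^{t(3^k+1)/2}x^{3^j+1}\big),$$ is a cubic bent function which is not weakly regular. Moreover, when $k$ is odd and $j\in\{0,2k\}$, $f$ is EA-equivalent to a function of the form $F(x,y_1,y_2)=g_{y_2}(x)+y_1\cdot y_2$ on $\mathbb{F}_3^{2k}\times\mathbb{F}_3^{k}\times\mathbb{F}_3^{k}$ (with $\cdot$ an inner product on $\mathbb{F}_3^k$), where each $g_c:\mathbb{F}_3^{2k}\to\mathbb{F}_3$, $c\in\mathbb{F}_3^k$, is bent; and in this case $f$ is dual-bent.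
   Context: $\mathrm{Tr}_n(x)=\sum_{i=0}^{n-1}x^{3^i}$; $\omega=e^{2\pi i/3}$; the Walsh transform of $h:\mathbb{F}_{3^n}\to\mathbb{F}_3$ is $W_h(y)=\sum_x\omega^{h(x)-\mathrm{Tr}_n(xy)}$ (similarly on $\mathbb{F}_3^m$ with the inner product replacing the trace). $h$ is bent if $|W_h(y)|^2=3^n$ for all $y$. For a bent $h$ one has $3^{-n/2}W_h(y)=\epsilon(y)\,\omega^{h^*(y)}$ with $\epsilon(y)\in\{\pm1,\pm i\}$, defining the dual $h^*:\mathbb{F}_{3^n}\to\mathbb{F}_3$; $h$ is weakly regular if there is $u\in\mathbb{C}$, $|u|=1$, with $3^{-n/2}W_h(y)=u\,\omega^{h^*(y)}$ for all $y$, and dual-bent if $h^*$ is bent. "Cubic" means algebraic degree $3$ (degree of the algebraic normal form in coordinates over $\mathbb{F}_3$). Two functions $h,h'$ on an $\mathbb{F}_3$-vector space are EA-equivalent if $h'=a\,(h\circ L)+l$ for an affine permutation $L$, an affine function $l$ and $a\in\mathbb{F}_3^*$ (here after identifying $\mathbb{F}_{3^n}$ with $\mathbb{F}_3^{4k}$ as $\mathbb{F}_3$-vector spaces). *)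

theory Defs
  imports "HOL-Analysis.Analysis" "HOL-Library.Numeral_Type"
begin

section \<open>The field with three elements\<close>

text \<open>The numeral type \<open>3\<close>, the integers modulo 3, is \<open>num1 bit1\<close>; the class \<open>CARD_1\<close>
  restricts the following instance to this type.\<close>

instantiation bit1 :: (CARD_1) field
begin

definition inverse_bit1 :: "'a bit1 \<Rightarrow> 'a bit1"
  where "inverse_bit1 x = x"

definition divide_bit1 :: "'a bit1 \<Rightarrow> 'a bit1 \<Rightarrow> 'a bit1"
  where "divide_bit1 x y = x * y"

instance
proof
  have three: "x = 0 \<or> x = 1 \<or> x = -1" for x :: "'a bit1"
  proof (cases x)
    case (of_int z)
    then have "z = 0 \<or> z = 1 \<or> z = 2" by (auto simp: CARD_1)
    moreover have "(of_int 2 :: 'a bit1) = -1"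
      using bit1.of_int_eq[where 'a='a, of 2] bit1.of_int_eq[where 'a='a, of "-1"]
      by (simp add: CARD_1)
    ultimately show ?thesis using of_int by auto
  qed
  show "inverse x * x = 1" if "x \<noteq> 0" for x :: "'a bit1"
    using three[of x] that by (auto simp: inverse_bit1_def)
  show "x div y = x * inverse y" for x y :: "'a bit1"
    by (simp add: inverse_bit1_def divide_bit1_def)
  show "inverse (0 :: 'a bit1) = 0"
    by (simp add: inverse_bit1_def)
qed

end

type_synonym F3 = "3"

text \<open>The image of a residue class modulo 3 in a field of characteristic 3.\<close>

definition of_F3 :: "F3 \<Rightarrow> 'a::ring_1"
  where "of_F3 c = of_int (Rep_bit1 c)"

text \<open>An abelian group of exponent 3 carries exactly one structure of a vector space over the
  field with three elements: \<open>c\<close> acts as the \<open>c\<close>-fold sum. On a field of characteristic 3 and on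
  tuples this is the usual scalar multiplication.\<close>

definition F3_scale :: "F3 \<Rightarrow> 'v::ab_group_add \<Rightarrow> 'v"
  where "F3_scale c v = (((+) v) ^^ nat (Rep_bit1 c)) 0"

lemma Rep_F3: "Rep_bit1 (0::F3) = 0" "Rep_bit1 (1::F3) = 1" "Rep_bit1 (2::F3) = 2"
  using bit1.Rep_numeral[where 'a=num1, of "Num.Bit0 Num.One"] by (simp_all add: bit1.Rep_0 bit1.Rep_1)

lemma F3_exhaust: "c = 0 \<or> c = 1 \<or> c = (2::F3)"
proof -
  have "Rep_bit1 c \<in> {0,1,2}" using Rep_bit1[of c] by auto
  then show ?thesis by (metis Rep_F3 Rep_bit1_inject insert_iff singletonD)
qed

lemma F3_scale_vec: "F3_scale c v = c *s (v :: F3 ^ 'm)"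
proof -
  have "1 *s v = v" "0 *s v = 0" "2 *s v = v + v" by (auto simp: vec_eq_iff)
  then show ?thesis using F3_exhaust[of c] by (auto simp: F3_scale_def Rep_F3 numeral_2_eq_2)
qed

lemma vector_space_F3_scale:
  assumes "\<And>v::'v::ab_group_add. v + v + v = 0"
  shows "vector_space (F3_scale :: F3 \<Rightarrow> 'v \<Rightarrow> 'v)"
proof -
  have s: "F3_scale 0 v = 0" "F3_scale 1 v = v" "F3_scale 2 v = v + v" for v :: 'v
    by (simp_all add: F3_scale_def Rep_F3 numeral_2_eq_2)
  have a: "v + (v + v) = 0" for v :: 'v using assms by (simp add: add.assoc)
  have b: "v + (v + (v + v)) = v" for v :: 'v using a[of v] by simp
  have three: "(3::F3) = 0" and four: "(4::F3) = 1" by simp_all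
  show ?thesis
  proof
    fix c d :: F3 and x y :: 'v
    show "F3_scale c (x + y) = F3_scale c x + F3_scale c y"
      using F3_exhaust[of c] by (auto simp: s algebra_simps)
    show "F3_scale (c + d) x = F3_scale c x + F3_scale d x"
      using F3_exhaust[of c] F3_exhaust[of d] by (auto simp: s three four a b add.assoc)
    show "F3_scale c (F3_scale d x) = F3_scale (c * d) x"
      using F3_exhaust[of c] F3_exhaust[of d] by (auto simp: s three four a b add.assoc)
    show "F3_scale 1 x = x" by (rule s)
  qed
qed

abbreviation F3_linear :: "('v::ab_group_add \<Rightarrow> 'w::ab_group_add) \<Rightarrow> bool"
  where "F3_linear \<equiv> Vector_Spaces.linear F3_scale F3_scale"

definition F3_affine :: "('v::ab_group_add \<Rightarrow> 'w::ab_group_add) \<Rightarrow> bool"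
  where "F3_affine f \<longleftrightarrow> (\<exists>A b. F3_linear A \<and> f = (\<lambda>v. A v + b))"

definition F3_basis :: "'v::ab_group_add set \<Rightarrow> bool"
  where "F3_basis B \<longleftrightarrow> \<not> module.dependent F3_scale B \<and> module.span F3_scale B = UNIV"


section \<open>Algebraic degree\<close>

text \<open>The algebraic normal form of \<open>h\<close> in the coordinates given by a basis \<open>B\<close>. The monomials are
  indexed by exponent vectors with entries at most 2, which makes the coefficients unique.\<close>

definition anf_exponents :: "'v set \<Rightarrow> ('v \<Rightarrow> nat) set"
  where "anf_exponents B = B \<rightarrow>\<^sub>E {0..2}"

definition is_anf :: "'v::ab_group_add set \<Rightarrow> ('v \<Rightarrow> F3) \<Rightarrow> (('v \<Rightarrow> nat) \<Rightarrow> F3) \<Rightarrow> bool"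
  where "is_anf B h c \<longleftrightarrow>
    (\<forall>v. h v = (\<Sum>e\<in>anf_exponents B. c e * (\<Prod>b\<in>B. module.representation F3_scale B v b ^ e b)))"

definition anf_degree :: "'v set \<Rightarrow> (('v \<Rightarrow> nat) \<Rightarrow> F3) \<Rightarrow> nat"
  where "anf_degree B c = Max (insert 0 {(\<Sum>b\<in>B. e b) |e. e \<in> anf_exponents B \<and> c e \<noteq> 0})"

text \<open>The degree does not depend on the coordinates, and every finite vector space has a basis and
  every function on it has an algebraic normal form. Existence is part of the definition, so that
  it cannot hold vacuously.\<close>

definition has_algebraic_degree :: "('v::{ab_group_add,finite} \<Rightarrow> F3) \<Rightarrow> nat \<Rightarrow> bool"
  where "has_algebraic_degree h d \<longleftrightarrow>
    (\<exists>B c. F3_basis B \<and> is_anf B h c) \<and>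
    (\<forall>B c. F3_basis B \<and> is_anf B h c \<longrightarrow> anf_degree B c = d)"

definition cubic :: "('v::{ab_group_add,finite} \<Rightarrow> F3) \<Rightarrow> bool"
  where "cubic h \<longleftrightarrow> has_algebraic_degree h 3"


section \<open>Trace and inner product\<close>

definition Tr :: "nat \<Rightarrow> 'a::field \<Rightarrow> F3"
  where "Tr n x = (THE c. of_F3 c = (\<Sum>i<n. x ^ (3 ^ i)))"

definition trace_form :: "nat \<Rightarrow> 'a::field \<Rightarrow> 'a \<Rightarrow> F3"
  where "trace_form n x y = Tr n (x * y)"

definition dot :: "F3 ^ 'm \<Rightarrow> F3 ^ 'm::finite \<Rightarrow> F3"
  where "dot x y = (\<Sum>i\<in>UNIV. x $ i * y $ i)"

definition primitive_element_of_subfield :: "nat \<Rightarrow> 'a::field \<Rightarrow> bool"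
  where "primitive_element_of_subfield q z \<longleftrightarrow> range (\<lambda>i::nat. z ^ i) = {x. x ^ q = x} - {0}"


section \<open>Bent functions\<close>

text \<open>The argument \<open>B\<close> is the bilinear form used in the Walsh transform, that is \<open>trace_form n\<close> on
  a field with \<open>3 ^ n\<close> elements and \<open>dot\<close> on tuples.\<close>

definition omega :: complex
  where "omega = exp (2 * of_real pi * \<i> / 3)"

definition omega_pow :: "F3 \<Rightarrow> complex"
  where "omega_pow c = omega ^ nat (Rep_bit1 c)"

definition walsh :: "('v::finite \<Rightarrow> 'v \<Rightarrow> F3) \<Rightarrow> ('v \<Rightarrow> F3) \<Rightarrow> 'v \<Rightarrow> complex"
  where "walsh B h y = (\<Sum>x\<in>UNIV. omega_pow (h x - B x y))"

definition normalized_walsh :: "('v::finite \<Rightarrow> 'v \<Rightarrow> F3) \<Rightarrow> ('v \<Rightarrow> F3) \<Rightarrow> 'v \<Rightarrow> complex"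
  where "normalized_walsh B h y = walsh B h y / of_real (sqrt (real CARD('v)))"

definition bent :: "('v::finite \<Rightarrow> 'v \<Rightarrow> F3) \<Rightarrow> ('v \<Rightarrow> F3) \<Rightarrow> bool"
  where "bent B h \<longleftrightarrow> (\<forall>y. (cmod (walsh B h y))\<^sup>2 = real CARD('v))"

text \<open>Only meaningful for bent \<open>h\<close>.\<close>

definition dual :: "('v::finite \<Rightarrow> 'v \<Rightarrow> F3) \<Rightarrow> ('v \<Rightarrow> F3) \<Rightarrow> 'v \<Rightarrow> F3"
  where "dual B h y =
    (THE c. \<exists>\<epsilon>\<in>{1, -1, \<i>, -\<i>}. normalized_walsh B h y = \<epsilon> * omega_pow c)"

definition weakly_regular :: "('v::finite \<Rightarrow> 'v \<Rightarrow> F3) \<Rightarrow> ('v \<Rightarrow> F3) \<Rightarrow> bool"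
  where "weakly_regular B h \<longleftrightarrow> bent B h \<and>
    (\<exists>u. cmod u = 1 \<and> (\<forall>y. normalized_walsh B h y = u * omega_pow (dual B h y)))"

definition dual_bent :: "('v::finite \<Rightarrow> 'v \<Rightarrow> F3) \<Rightarrow> ('v \<Rightarrow> F3) \<Rightarrow> bool"
  where "dual_bent B h \<longleftrightarrow> bent B h \<and> bent B (dual B h)"


section \<open>EA-equivalence\<close>

text \<open>The domains may be different vector spaces: the linear identification between them is
  absorbed into the affine bijection \<open>L\<close>.\<close>

definition EA_equivalent ::
    "('v::ab_group_add \<Rightarrow> F3) \<Rightarrow> ('w::ab_group_add \<Rightarrow> F3) \<Rightarrow> bool"
  where "EA_equivalent h h' \<longleftrightarrow>
    (\<exists>a L l. a \<noteq> 0 \<and> F3_affine L \<and> bij L \<and> F3_affine l \<and> h' = (\<lambda>w. a * h (L w) + l w))"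

end

theory Submission
  imports Defs "HOL-Computational_Algebra.Polynomial"
begin

text \<open>
  Let \<open>q = 3 ^ k\<close> and \<open>\<sigma> x = x ^ q\<close>, write \<open>\<alpha>\<close> for the coefficient of the quadratic term, and let
  \<open>E\<close>, \<open>A\<close>, \<open>W\<close> be the subspaces \<open>\<sigma> x = x\<close>, \<open>\<sigma> x = - x\<close>, \<open>\<sigma> (\<sigma> x) = - x\<close>. The field is their
  direct sum, \<open>\<alpha> \<in> A\<close>, and on \<open>v + s + w\<close> the function takes the value
  \<open>G s w + \<beta> v s\<close>, where \<open>G s\<close> is the quadratic form \<open>Tr (s * w * \<sigma> w + \<alpha> * w ^ (3 ^ j + 1))\<close>
  on \<open>W\<close> and \<open>\<beta>\<close> is bilinear on \<open>E \<times> A\<close>. Comparing 2-adic valuations of \<open>3 ^ j \<plusminus> 1\<close> and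
  \<open>3 ^ k \<plusminus> 1\<close> for \<open>j\<close> and \<open>k\<close> of different parity shows that \<open>\<beta>\<close> and the polar forms of all
  \<open>G s\<close> are nondegenerate. Hence the function is bent, up to a linear bijection it is
  \<open>G s w\<close> plus an inner product, and its dual has the same shape. The signs of the Walsh transform are
  those of the Gauss sums of the forms \<open>G s\<close>; the sum of these over \<open>s \<in> A\<close> is \<open>q\<close>, while each
  of the \<open>q\<close> summands has modulus \<open>q\<close>, so they cannot all be equal.
\<close>

section \<open>Characters of order three\<close>

lemma F3_cases:
  obtains "c = 0" | "c = 1" | "c = (2::F3)"
  using F3_exhaust[of c] by blast

lemma F3_numerals: "(3::F3) = 0" "(4::F3) = 1" "(5::F3) = 2" "(6::F3) = 0" "- 1 = (2::F3)" "- 2 = (1::F3)"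
  by simp_all

lemma F3_triple: "c + c + c = (0::F3)"
  by (cases c rule: F3_cases) (simp_all add: F3_numerals)

lemma F3_eq_uminus_self: "c = - c \<longleftrightarrow> c = (0::F3)"
  by (cases c rule: F3_cases) (simp_all add: F3_numerals)

lemma omega_cubed: "omega ^ 3 = 1"
proof -
  have "omega ^ 3 = exp (of_nat 3 * (2 * of_real pi * \<i> / 3))"
    unfolding omega_def by (rule exp_of_nat_mult[symmetric])
  also have "of_nat 3 * (2 * of_real pi * \<i> / 3) = 2 * of_real pi * \<i>" by simp
  finally show ?thesis by (simp only: exp_two_pi_i)
qed

lemma omega_eq: "omega = Complex (- 1 / 2) (sqrt 3 / 2)"
proof -
  have "omega = cis (2 * pi / 3)"
    unfolding omega_def cis_conv_exp by (simp add: mult.commute)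
  also have "\<dots> = Complex (- 1 / 2) (sqrt 3 / 2)"
    by (simp add: cis.code cos_120 sin_120)
  finally show ?thesis .
qed

lemma omega_pow_simps [simp]:
  "omega_pow 0 = 1" "omega_pow 1 = omega" "omega_pow 2 = omega\<^sup>2"
  by (simp_all add: omega_pow_def Rep_F3 nat_numeral)

lemma omega_pow_add: "omega_pow (a + b) = omega_pow a * omega_pow b"
proof -
  have "omega * omega = omega\<^sup>2" "omega * omega\<^sup>2 = 1" "omega\<^sup>2 * omega = 1" "omega\<^sup>2 * omega\<^sup>2 = omega"
    using omega_cubed by (simp_all add: power2_eq_square power3_eq_cube algebra_simps)
  then show ?thesis
    by (cases a rule: F3_cases; cases b rule: F3_cases) (simp_all add: F3_numerals)
qed

lemma norm_omega [simp]: "cmod omega = 1"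
  unfolding omega_def by (metis norm_exp_i_times mult.commute mult.left_commute times_divide_eq_right of_real_mult of_real_numeral of_real_divide)

lemma norm_omega_pow [simp]: "cmod (omega_pow c) = 1"
  by (simp add: omega_pow_def norm_power)

lemma omega_pow_eq_1_iff [simp]: "omega_pow c = 1 \<longleftrightarrow> c = 0"
  by (cases c rule: F3_cases) (simp_all add: omega_eq complex_eq_iff power2_eq_square)

lemma omega_pow_nonzero [simp]: "omega_pow c \<noteq> 0"
  by (metis norm_omega_pow norm_zero zero_neq_one)

lemma cnj_omega_pow: "cnj (omega_pow c) = omega_pow (- c)"
proof -
  have "omega_pow c * omega_pow (- c) = 1"
    unfolding omega_pow_add[symmetric] by simp
  moreover have "omega_pow c * cnj (omega_pow c) = 1"
    by (metis complex_norm_square norm_omega_pow of_real_1 one_power2 of_real_power)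
  ultimately show ?thesis
    by (metis mult_left_cancel omega_pow_nonzero)
qed

lemma omega_pow_4: "omega_pow c ^ 4 = omega_pow c"
proof -
  have "omega_pow c ^ 4 = omega_pow (c + c + (c + c))"
    unfolding omega_pow_add power4_eq_xxxx by (simp only: mult.assoc)
  also have "c + c + (c + c) = c" using F3_triple[of c] by (simp add: add.assoc)
  finally show ?thesis .
qed

text \<open>Fourth powers send the units \<open>\<epsilon>\<close> and \<open>\<delta>\<close> to 1
  and fix every cube root of unity. This makes the value described in \<open>dual\<close>
  unique.\<close>

lemma omega_pow_inject_upto_unit:
  assumes "\<epsilon> \<in> {1, -1, \<i>, -\<i>}" "\<delta> \<in> {1, -1, \<i>, -\<i>}"
    and eq: "\<epsilon> * omega_pow a = \<delta> * omega_pow b"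
  shows "a = b"
proof -
  have *: "\<epsilon> ^ 4 = 1" "\<delta> ^ 4 = 1"
    using assms(1,2) by (auto simp: power4_eq_xxxx)
  have "omega_pow a = (\<epsilon> * omega_pow a) ^ 4" by (simp add: * power_mult_distrib omega_pow_4)
  also have "\<dots> = omega_pow b" unfolding eq by (simp add: * power_mult_distrib omega_pow_4)
  finally have "omega_pow (a - b) = 1"
    by (metis add_diff_cancel_left' diff_add_cancel mult_cancel_right2 omega_pow_add omega_pow_nonzero)
  then show ?thesis by simp
qed

section \<open>Character sums over additive subgroups\<close>

definition add_subgroup :: "'v::ab_group_add set \<Rightarrow> bool"
  where "add_subgroup H \<longleftrightarrow> 0 \<in> H \<and> (\<forall>x\<in>H. \<forall>y\<in>H. x - y \<in> H)"

lemma add_subgroup_UNIV [simp]: "add_subgroup UNIV"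
  by (simp add: add_subgroup_def)

lemma add_subgroupD:
  assumes "add_subgroup H"
  shows "0 \<in> H" "x \<in> H \<Longrightarrow> y \<in> H \<Longrightarrow> x - y \<in> H" "x \<in> H \<Longrightarrow> - x \<in> H"
    "x \<in> H \<Longrightarrow> y \<in> H \<Longrightarrow> x + y \<in> H"
proof -
  show z: "0 \<in> H" and m: "x \<in> H \<Longrightarrow> y \<in> H \<Longrightarrow> x - y \<in> H" for x y
    using assms by (auto simp: add_subgroup_def)
  show u: "x \<in> H \<Longrightarrow> - x \<in> H" for x using m[OF z, of x] by simp
  show "x \<in> H \<Longrightarrow> y \<in> H \<Longrightarrow> x + y \<in> H" for x y
    using m[of x "- y"] u[of y] by simp
qed

lemma sum_translate:
  assumes "add_subgroup H" "h \<in> H"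
  shows "(\<Sum>x\<in>H. F (x + h)) = sum F H"
  by (rule sum.reindex_bij_witness[of _ "\<lambda>x. x - h" "\<lambda>x. x + h"])
     (use assms add_subgroupD[OF assms(1)] in auto)

lemma sum_translate_UNIV: "(\<Sum>x\<in>UNIV. F (x + h)) = sum F (UNIV :: 'v::{ab_group_add,finite} set)"
  by (rule sum_translate) simp_all

text \<open>Translation by \<open>h\<close> multiplies the sum by \<open>omega_pow (g h)\<close>,
  which differs from 1.\<close>

lemma sum_character_eq_0:
  assumes H: "add_subgroup H"
    and add: "\<And>x y. x \<in> H \<Longrightarrow> y \<in> H \<Longrightarrow> g (x + y) = g x + g y"
    and "h \<in> H" "g h \<noteq> 0"
  shows "(\<Sum>x\<in>H. omega_pow (c + g x)) = 0"
proof -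
  have "(\<Sum>x\<in>H. omega_pow (c + g x)) = (\<Sum>x\<in>H. omega_pow (c + g (x + h)))"
    by (rule sum_translate[symmetric]) fact+
  also have "\<dots> = omega_pow (g h) * (\<Sum>x\<in>H. omega_pow (c + g x))"
    using assms(3) by (auto simp: sum_distrib_left add omega_pow_add algebra_simps intro!: sum.cong)
  finally show ?thesis using assms(4) by (metis mult_cancel_right2 omega_pow_eq_1_iff)
qed

text \<open>Summing over all translates by \<open>H\<close> counts the full sum
  \<open>card H\<close> times, so cancellation on every coset of \<open>H\<close> suffices.\<close>

lemma sum_eq_0_by_translates:
  fixes F :: "'v::{ab_group_add,finite} \<Rightarrow> complex"
  assumes "add_subgroup H" "\<And>x. (\<Sum>h\<in>H. F (x + h)) = 0"
  shows "sum F UNIV = 0"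
proof -
  have "of_nat (card H) * sum F UNIV = (\<Sum>h\<in>H. \<Sum>x\<in>UNIV. F (x + h))"
    by (simp add: sum_translate_UNIV)
  also have "\<dots> = (\<Sum>x\<in>UNIV. \<Sum>h\<in>H. F (x + h))" by (rule sum.swap)
  also have "\<dots> = 0" using assms(2) by simp
  finally show ?thesis
    using add_subgroupD(1)[OF assms(1)] by (auto simp: card_eq_0_iff)
qed

text \<open>The squared modulus is a double sum; ordering it by the difference \<open>a\<close> of
  the two arguments produces the character sums of the derivatives, of which only the one for
  \<open>a = 0\<close> survives.\<close>

lemma bent_if_derivatives_balanced:
  fixes h :: "'v::{ab_group_add,finite} \<Rightarrow> F3"
  assumes B: "\<And>x a y. B (x + a) y = B x y + B a y"
    and balanced: "\<And>a. a \<noteq> 0 \<Longrightarrow> (\<Sum>x\<in>UNIV. omega_pow (h (x + a) - h x)) = 0"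
  shows "bent B h"
  unfolding bent_def
proof
  fix y
  have B0: "B 0 y = 0" using B[of 0 0 y] by simp
  have "complex_of_real ((cmod (walsh B h y))\<^sup>2) = walsh B h y * cnj (walsh B h y)"
    using complex_norm_square[of "walsh B h y"] by simp
  also have "\<dots> = (\<Sum>x\<in>UNIV. \<Sum>z\<in>UNIV. omega_pow (h z - B z y) * omega_pow (- (h x - B x y)))"
    by (simp add: walsh_def cnj_omega_pow sum_product) (rule sum.swap)
  also have "\<dots> = (\<Sum>x\<in>UNIV. \<Sum>a\<in>UNIV. omega_pow (- B a y) * omega_pow (h (x + a) - h x))"
  proof (rule sum.cong[OF refl])
    fix x
    have "(\<Sum>z\<in>UNIV. omega_pow (h z - B z y) * omega_pow (- (h x - B x y))) =
          (\<Sum>a\<in>UNIV. omega_pow (h (a + x) - B (a + x) y) * omega_pow (- (h x - B x y)))"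
      by (rule sum_translate_UNIV[symmetric])
    also have "\<dots> = (\<Sum>a\<in>UNIV. omega_pow (- B a y) * omega_pow (h (x + a) - h x))"
      unfolding omega_pow_add[symmetric] by (simp add: B algebra_simps)
    finally show "(\<Sum>z\<in>UNIV. omega_pow (h z - B z y) * omega_pow (- (h x - B x y))) =
          (\<Sum>a\<in>UNIV. omega_pow (- B a y) * omega_pow (h (x + a) - h x))" .
  qed
  also have "\<dots> = (\<Sum>a\<in>UNIV. omega_pow (- B a y) * (\<Sum>x\<in>UNIV. omega_pow (h (x + a) - h x)))"
    by (subst sum.swap) (simp add: sum_distrib_left)
  also have "\<dots> = (\<Sum>a\<in>{0}. omega_pow (- B a y) * (\<Sum>x\<in>UNIV. omega_pow (h (x + a) - h x)))"
    by (rule sum.mono_neutral_right) (auto simp: balanced)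
  also have "\<dots> = complex_of_real (real CARD('v))" by (simp add: B0)
  finally show "(cmod (walsh B h y))\<^sup>2 = real CARD('v)" by (simp only: of_real_eq_iff)
qed

section \<open>Functions that are quadratic on fibres\<close>

text \<open>The derivative in direction \<open>a\<close> is a nonconstant affine function on every
  coset of one of \<open>V\<close>, \<open>W\<close>, \<open>S\<close>, so its character sum
  vanishes there. The lemma serves twice: for \<open>f\<close> with \<open>V = E\<close> and
  \<open>S = A\<close>, and for its dual with these two exchanged.\<close>

lemma bent_if_quadratic_fibres:
  fixes h :: "'v::{ab_group_add,finite} \<Rightarrow> F3"
  assumes B: "\<And>x a y. B (x + a) y = B x y + B a y"
    and V: "add_subgroup V" and S: "add_subgroup S" and W: "add_subgroup W"
    and decompose: "\<And>x. \<exists>v\<in>V. \<exists>s\<in>S. \<exists>w\<in>W. x = v + s + w"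
    and h: "\<And>v s w. v \<in> V \<Longrightarrow> s \<in> S \<Longrightarrow> w \<in> W \<Longrightarrow> h (v + s + w) = Q s w + b v s"
    and b_left: "\<And>v v' s. v \<in> V \<Longrightarrow> v' \<in> V \<Longrightarrow> s \<in> S \<Longrightarrow> b (v + v') s = b v s + b v' s"
    and b_right: "\<And>v s s'. v \<in> V \<Longrightarrow> s \<in> S \<Longrightarrow> s' \<in> S \<Longrightarrow> b v (s + s') = b v s + b v s'"
    and b_nondeg_left: "\<And>v. v \<in> V \<Longrightarrow> v \<noteq> 0 \<Longrightarrow> \<exists>s\<in>S. b v s \<noteq> 0"
    and b_nondeg_right: "\<And>s. s \<in> S \<Longrightarrow> s \<noteq> 0 \<Longrightarrow> \<exists>v\<in>V. b v s \<noteq> 0"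
    and Q: "\<And>s w u. s \<in> S \<Longrightarrow> w \<in> W \<Longrightarrow> u \<in> W \<Longrightarrow> Q s (w + u) = Q s w + Q s u + c s w u"
    and c: "\<And>s w w' u. s \<in> S \<Longrightarrow> w \<in> W \<Longrightarrow> w' \<in> W \<Longrightarrow> u \<in> W \<Longrightarrow> c s (w + w') u = c s w u + c s w' u"
    and c_nondeg: "\<And>s u. s \<in> S \<Longrightarrow> u \<in> W \<Longrightarrow> u \<noteq> 0 \<Longrightarrow> \<exists>w\<in>W. c s w u \<noteq> 0"
  shows "bent B h"
proof (rule bent_if_derivatives_balanced[OF B])
  fix a :: 'v
  assume "a \<noteq> 0"
  obtain v0 s0 w0 where a: "a = v0 + s0 + w0" and [simp]: "v0 \<in> V" "s0 \<in> S" "w0 \<in> W"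
    using decompose by blast
  note [simp] = add_subgroupD(4)[OF V] add_subgroupD(4)[OF S] add_subgroupD(4)[OF W]
    add_subgroupD(1)[OF V] add_subgroupD(1)[OF S] add_subgroupD(1)[OF W]
  have h': "h x = Q s w + b v s" if "x = v + s + w" "v \<in> V" "s \<in> S" "w \<in> W" for x v s w
    using h that by simp
  \<comment> \<open>The order of the cases matters. Moving along \<open>V\<close> leaves the
    arguments of \<open>Q\<close> unchanged whatever \<open>w0\<close> is. Once
    \<open>s0 = 0\<close>, both values of \<open>Q\<close> belong to the same \<open>s\<close>, and
    moving along \<open>W\<close> brings in its polar form. Once also \<open>w0 = 0\<close>, the
    values of \<open>Q\<close> cancel and only \<open>b v0\<close> remains.\<close>
  consider "s0 \<noteq> 0" | "s0 = 0" "w0 \<noteq> 0" | "s0 = 0" "w0 = 0" "v0 \<noteq> 0"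
    using \<open>a \<noteq> 0\<close> a by (cases "s0 = 0"; cases "w0 = 0") auto
  then show "(\<Sum>x\<in>UNIV. omega_pow (h (x + a) - h x)) = 0"
  proof cases
    case 1
    then obtain v1 where v1: "v1 \<in> V" "b v1 s0 \<noteq> 0" using b_nondeg_right[OF \<open>s0 \<in> S\<close>] by blast
    show ?thesis
    proof (rule sum_eq_0_by_translates[OF V])
      fix x
      obtain v s w where x: "x = v + s + w" and [simp]: "v \<in> V" "s \<in> S" "w \<in> W"
        using decompose by blast
      have "h (x + v' + a) - h (x + v') = (h (x + a) - h x) + b v' s0" if [simp]: "v' \<in> V" for v'
      proof -
        have "h (x + v' + a) = Q (s + s0) (w + w0) + b (v + v' + v0) (s + s0)"
          by (rule h') (simp_all add: x a algebra_simps)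
        moreover have "h (x + v') = Q s w + b (v + v') s"
          by (rule h') (simp_all add: x a algebra_simps)
        moreover have "h (x + a) = Q (s + s0) (w + w0) + b (v + v0) (s + s0)"
          by (rule h') (simp_all add: x a algebra_simps)
        moreover have "h x = Q s w + b v s"
          by (rule h') (simp_all add: x)
        ultimately show ?thesis by (simp add: b_left b_right)
      qed
      then have "(\<Sum>v'\<in>V. omega_pow (h (x + v' + a) - h (x + v'))) =
        (\<Sum>v'\<in>V. omega_pow ((h (x + a) - h x) + b v' s0))" by simp
      also have "\<dots> = 0"
        by (rule sum_character_eq_0[OF V, where g = "\<lambda>v'. b v' s0" and h = v1])
           (use v1 in \<open>simp_all add: b_left\<close>)
      finally show "(\<Sum>v'\<in>V. omega_pow (h (x + v' + a) - h (x + v'))) = 0" .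
    qed
  next
    case 2
    show ?thesis
    proof (rule sum_eq_0_by_translates[OF W])
      fix x
      obtain v s w where x: "x = v + s + w" and [simp]: "v \<in> V" "s \<in> S" "w \<in> W"
        using decompose by blast
      obtain w1 where w1: "w1 \<in> W" "c s w1 w0 \<noteq> 0" using c_nondeg[OF \<open>s \<in> S\<close> \<open>w0 \<in> W\<close>] 2 by blast
      have "h (x + w' + a) - h (x + w') = (h (x + a) - h x) + c s w' w0" if [simp]: "w' \<in> W" for w'
      proof -
        have "h (x + w' + a) = Q s (w + w' + w0) + b (v + v0) s"
          by (rule h') (simp_all add: x a 2 algebra_simps)
        moreover have "h (x + w') = Q s (w + w') + b v s"
          by (rule h') (simp_all add: x a 2 algebra_simps)
        moreover have "h (x + a) = Q s (w + w0) + b (v + v0) s"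
          by (rule h') (simp_all add: x a 2 algebra_simps)
        moreover have "h x = Q s w + b v s"
          by (rule h') (simp_all add: x)
        ultimately show ?thesis by (simp add: Q c)
      qed
      then have "(\<Sum>w'\<in>W. omega_pow (h (x + w' + a) - h (x + w'))) =
        (\<Sum>w'\<in>W. omega_pow ((h (x + a) - h x) + c s w' w0))" by simp
      also have "\<dots> = 0"
        by (rule sum_character_eq_0[OF W, where g = "\<lambda>w'. c s w' w0" and h = w1])
           (use w1 in \<open>simp_all add: c\<close>)
      finally show "(\<Sum>w'\<in>W. omega_pow (h (x + w' + a) - h (x + w'))) = 0" .
    qed
  next
    case 3
    then obtain s1 where s1: "s1 \<in> S" "b v0 s1 \<noteq> 0" using b_nondeg_left[OF \<open>v0 \<in> V\<close>] by blast
    show ?thesis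
    proof (rule sum_eq_0_by_translates[OF S])
      fix x
      obtain v s w where x: "x = v + s + w" and [simp]: "v \<in> V" "s \<in> S" "w \<in> W"
        using decompose by blast
      have "h (x + s' + a) - h (x + s') = b v0 s + b v0 s'" if [simp]: "s' \<in> S" for s'
      proof -
        have "h (x + s' + a) = Q (s + s') w + b (v + v0) (s + s')"
          by (rule h') (simp_all add: x a 3 algebra_simps)
        moreover have "h (x + s') = Q (s + s') w + b v (s + s')"
          by (rule h') (simp_all add: x a 3 algebra_simps)
        ultimately show ?thesis by (simp add: b_left b_right)
      qed
      then have "(\<Sum>s'\<in>S. omega_pow (h (x + s' + a) - h (x + s'))) =
        (\<Sum>s'\<in>S. omega_pow (b v0 s + b v0 s'))" by simp
      also have "\<dots> = 0"
        by (rule sum_character_eq_0[OF S, where g = "\<lambda>s'. b v0 s'" and h = s1])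
           (use s1 in \<open>simp_all add: b_right\<close>)
      finally show "(\<Sum>s'\<in>S. omega_pow (h (x + s' + a) - h (x + s'))) = 0" .
    qed
  qed
qed

section \<open>The function over an abstract cyclic quartic extension\<close>

text \<open>The field automorphisms stand for \<open>\<sigma> x = x ^ (3 ^ k)\<close> and \<open>\<rho> x = x ^ (3 ^ j)\<close>, with \<open>\<rho>'\<close>
  the inverse of \<open>\<rho>\<close>. The opposite parity of \<open>j\<close> and \<open>k\<close> enters only through the assumptions
  \<open>no_common_anti\<close> and \<open>no_common_norm\<close>.\<close>

locale quartic_setting =
  fixes \<sigma> \<rho> \<rho>' :: "'a::{field,finite} \<Rightarrow> 'a" and tr :: "'a \<Rightarrow> F3" and \<alpha> :: 'a
  assumes char3: "(3::'a) = 0"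
    and \<sigma>_add: "\<sigma> (x + y) = \<sigma> x + \<sigma> y" and \<sigma>_mult: "\<sigma> (x * y) = \<sigma> x * \<sigma> y"
    and \<sigma>_4: "\<sigma> (\<sigma> (\<sigma> (\<sigma> x))) = x"
    and \<rho>_add: "\<rho> (x + y) = \<rho> x + \<rho> y" and \<rho>_mult: "\<rho> (x * y) = \<rho> x * \<rho> y"
    and \<rho>_\<rho>': "\<rho> (\<rho>' x) = x" and \<rho>'_\<rho>: "\<rho>' (\<rho> x) = x"
    and \<sigma>_\<rho>: "\<sigma> (\<rho> x) = \<rho> (\<sigma> x)"
    and tr_add: "tr (x + y) = tr x + tr y"
    and tr_\<sigma>: "tr (\<sigma> x) = tr x" and tr_\<rho>: "tr (\<rho> x) = tr x"
    and tr_nondegenerate: "x \<noteq> 0 \<Longrightarrow> \<exists>y. tr (x * y) \<noteq> 0"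
    and \<alpha>: "\<alpha> \<noteq> 0" "\<sigma> \<alpha> = - \<alpha>"
    and no_common_anti: "\<sigma> x = - x \<Longrightarrow> \<rho> x = - x \<Longrightarrow> x = 0"
    and no_common_norm: "g * \<sigma> g = - 1 \<Longrightarrow> g * \<rho> g \<noteq> - 1"
    and W_nontrivial: "\<exists>w. w \<noteq> 0 \<and> \<sigma> (\<sigma> w) = - w"
begin

section \<open>The splitting into \<open>E\<close>, \<open>A\<close> and \<open>W\<close>\<close>

definition E :: "'a set" where "E = {x. \<sigma> x = x}"
definition A :: "'a set" where "A = {x. \<sigma> x = - x}"
definition W :: "'a set" where "W = {x. \<sigma> (\<sigma> x) = - x}"

text \<open>The usual projections for an operator with fourth power 1 carry factors 1/4, 1/4 and
  1/2; modulo 3 these are 1, 1 and -1, which explains the sign of \<open>prW\<close>.\<close>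

definition prE where "prE y = y + \<sigma> y + \<sigma> (\<sigma> y) + \<sigma> (\<sigma> (\<sigma> y))"
definition prA where "prA y = y - \<sigma> y + \<sigma> (\<sigma> y) - \<sigma> (\<sigma> (\<sigma> y))"
definition prW where "prW y = \<sigma> (\<sigma> y) - y"

lemma three_mult: "3 * x = (0::'a)"
  unfolding char3 by (rule mult_zero_left)

lemma four_mult: "4 * x = (x::'a)"
proof -
  have "4 * x = 3 * x + x" by simp
  then show ?thesis unfolding three_mult by simp
qed

lemma triple: "x + x + x = (0::'a)"
proof -
  have "x + x + x = 3 * x" by simp
  then show ?thesis unfolding three_mult .
qed

lemma double_eq: "x + x = - (x::'a)"
  by (rule minus_unique[symmetric]) (simp only: triple add.assoc[symmetric])

lemma \<sigma>_simps [simp]: "\<sigma> 0 = 0" "\<sigma> (- x) = - \<sigma> x" "\<sigma> (x - y) = \<sigma> x - \<sigma> y"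
proof -
  show z: "\<sigma> 0 = 0" using \<sigma>_add[of 0 0] by (simp only: add_0_right add_cancel_right_right)
  show m: "\<sigma> (- x) = - \<sigma> x" for x by (rule minus_unique[symmetric]) (simp flip: \<sigma>_add add: z)
  show "\<sigma> (x - y) = \<sigma> x - \<sigma> y" using \<sigma>_add[of x "- y"] m[of y] by (simp only: diff_conv_add_uminus)
qed

lemma \<rho>_simps [simp]: "\<rho> 0 = 0" "\<rho> (- x) = - \<rho> x" "\<rho> (x - y) = \<rho> x - \<rho> y"
proof -
  show z: "\<rho> 0 = 0" using \<rho>_add[of 0 0] by (simp only: add_0_right add_cancel_right_right)
  show m: "\<rho> (- x) = - \<rho> x" for x by (rule minus_unique[symmetric]) (simp flip: \<rho>_add add: z)
  show "\<rho> (x - y) = \<rho> x - \<rho> y" using \<rho>_add[of x "- y"] m[of y] by (simp only: diff_conv_add_uminus)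
qed

lemma \<rho>'_add: "\<rho>' (x + y) = \<rho>' x + \<rho>' y"
  using arg_cong[OF \<rho>_add[of "\<rho>' x" "\<rho>' y"], of \<rho>'] unfolding \<rho>_\<rho>' \<rho>'_\<rho> by simp

lemma \<rho>'_mult: "\<rho>' (x * y) = \<rho>' x * \<rho>' y"
  using arg_cong[OF \<rho>_mult[of "\<rho>' x" "\<rho>' y"], of \<rho>'] unfolding \<rho>_\<rho>' \<rho>'_\<rho> by simp

lemma \<rho>'_simps [simp]: "\<rho>' 0 = 0" "\<rho>' (- x) = - \<rho>' x" "\<rho>' (x - y) = \<rho>' x - \<rho>' y"
  using arg_cong[OF \<rho>_simps(1), of \<rho>'] arg_cong[OF \<rho>_simps(2)[of "\<rho>' x"], of \<rho>']
    arg_cong[OF \<rho>_simps(3)[of "\<rho>' x" "\<rho>' y"], of \<rho>']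
  unfolding \<rho>_\<rho>' \<rho>'_\<rho> by simp_all

lemma \<sigma>_\<rho>': "\<sigma> (\<rho>' x) = \<rho>' (\<sigma> x)"
  by (metis \<rho>_\<rho>' \<rho>'_\<rho> \<sigma>_\<rho>)

lemma \<sigma>_eq_0_iff: "\<sigma> x = 0 \<longleftrightarrow> x = 0"
  using \<sigma>_4[of x] by auto

lemma \<rho>_eq_0_iff: "\<rho> x = 0 \<longleftrightarrow> x = 0"
  using \<rho>'_\<rho>[of x] by auto

lemma tr_\<rho>': "tr (\<rho>' x) = tr x"
  by (metis \<rho>_\<rho>' tr_\<rho>)

lemma tr_simps [simp]: "tr 0 = 0" "tr (- x) = - tr x" "tr (x - y) = tr x - tr y"
proof -
  show z: "tr 0 = 0" using tr_add[of 0 0] by (simp only: add_0_right add_cancel_right_right)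
  show m: "tr (- x) = - tr x" for x by (rule minus_unique[symmetric]) (simp flip: tr_add add: z)
  show "tr (x - y) = tr x - tr y" using tr_add[of x "- y"] m[of y] by (simp only: diff_conv_add_uminus)
qed

text \<open>Invariance of the trace gives \<open>tr x = - tr x\<close>. This fact and its analogue
  for the square of \<open>\<sigma>\<close> remove most terms when \<open>f\<close> is
  expanded.\<close>

lemma tr_anti_\<sigma>: "\<sigma> x = - x \<Longrightarrow> tr x = 0"
  by (metis F3_eq_uminus_self tr_\<sigma> tr_simps(2))

lemma tr_anti_\<sigma>\<sigma>: "\<sigma> (\<sigma> x) = - x \<Longrightarrow> tr x = 0"
  by (metis F3_eq_uminus_self tr_\<sigma> tr_simps(2))

lemma add_subgroups: "add_subgroup E" "add_subgroup A" "add_subgroup W"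
  by (auto simp: add_subgroup_def E_def A_def W_def)

lemma pr_mem [simp]: "prE y \<in> E" "prA y \<in> A" "prW y \<in> W"
  by (simp_all add: E_def A_def W_def prE_def prA_def prW_def \<sigma>_add \<sigma>_4)

lemma pr_sum: "prE y + prA y + prW y = y"
proof -
  have "prE y + prA y + prW y = y + 3 * \<sigma> (\<sigma> y)"
    by (simp add: prE_def prA_def prW_def algebra_simps)
  then show ?thesis by (simp only: three_mult add_0_right)
qed

lemma pr_of_sum:
  assumes "v \<in> E" "s \<in> A" "w \<in> W"
  shows "prE (v + s + w) = v" "prA (v + s + w) = s" "prW (v + s + w) = w"
proof -
  have [simp]: "\<sigma> v = v" "\<sigma> s = - s" "\<sigma> (\<sigma> w) = - w"
    using assms by (auto simp: E_def A_def W_def)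
  have "prE (v + s + w) = 4 * v" "prA (v + s + w) = 4 * s" "prW (v + s + w) = w - 3 * w"
    by (simp_all add: prE_def prA_def prW_def \<sigma>_add algebra_simps)
  then show "prE (v + s + w) = v" "prA (v + s + w) = s" "prW (v + s + w) = w"
    by (simp_all only: four_mult three_mult diff_0_right)
qed

lemma decompose: "\<exists>v\<in>E. \<exists>s\<in>A. \<exists>w\<in>W. x = v + s + w"
  using pr_sum[of x] pr_mem by metis

lemma bij_betw_decomposition: "bij_betw (\<lambda>(v, s, w). v + s + w) (E \<times> A \<times> W) UNIV"
  by (rule bij_betw_byWitness[where f' = "\<lambda>x. (prE x, prA x, prW x)"])
     (auto simp: pr_of_sum pr_sum)

text \<open>Each of these products changes sign under \<open>\<sigma>\<close> or under its
  square.\<close>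

lemma tr_orthogonal:
  assumes "v \<in> E" "s \<in> A" "w \<in> W"
  shows "tr (v * s) = 0" "tr (s * v) = 0" "tr (v * w) = 0" "tr (w * v) = 0" "tr (s * w) = 0" "tr (w * s) = 0"
proof -
  have [simp]: "\<sigma> v = v" "\<sigma> s = - s" "\<sigma> (\<sigma> w) = - w"
    using assms by (auto simp: E_def A_def W_def)
  show "tr (v * s) = 0" "tr (s * v) = 0"
    by (rule tr_anti_\<sigma>; simp add: \<sigma>_mult)+
  show "tr (v * w) = 0" "tr (w * v) = 0" "tr (s * w) = 0" "tr (w * s) = 0"
    by (rule tr_anti_\<sigma>\<sigma>; simp add: \<sigma>_mult)+
qed

lemma tr_mult_sum:
  assumes "v \<in> E" "s \<in> A" "w \<in> W" "v' \<in> E" "s' \<in> A" "w' \<in> W"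
  shows "tr ((v + s + w) * (v' + s' + w')) = tr (v * v') + tr (s * s') + tr (w * w')"
  using assms by (simp add: distrib_left distrib_right tr_add tr_orthogonal)

lemma tr_mult_pr:
  shows "v \<in> E \<Longrightarrow> tr (v * y) = tr (v * prE y)" "s \<in> A \<Longrightarrow> tr (s * y) = tr (s * prA y)"
    "w \<in> W \<Longrightarrow> tr (w * y) = tr (w * prW y)"
  using tr_mult_sum[of v 0 0 "prE y" "prA y" "prW y"] tr_mult_sum[of 0 s 0 "prE y" "prA y" "prW y"]
    tr_mult_sum[of 0 0 w "prE y" "prA y" "prW y"] add_subgroupD(1)[OF add_subgroups(1)]
    add_subgroupD(1)[OF add_subgroups(2)] add_subgroupD(1)[OF add_subgroups(3)]
  by (simp_all add: pr_sum)

text \<open>By orthogonality, an element that pairs nontrivially with the given one may be replaced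
  by its projection to the same subspace.\<close>

lemma tr_nondegenerate_on:
  shows "v \<in> E \<Longrightarrow> v \<noteq> 0 \<Longrightarrow> \<exists>x\<in>E. tr (x * v) \<noteq> 0"
    "s \<in> A \<Longrightarrow> s \<noteq> 0 \<Longrightarrow> \<exists>x\<in>A. tr (x * s) \<noteq> 0"
    "w \<in> W \<Longrightarrow> w \<noteq> 0 \<Longrightarrow> \<exists>x\<in>W. tr (x * w) \<noteq> 0"
  using tr_nondegenerate tr_mult_pr pr_mem by (metis mult.commute)+

text \<open>The polar forms: \<open>M\<close> pairs \<open>E\<close> with \<open>A\<close>, and \<open>N s\<close> is the polar form of the
  restriction of \<open>f\<close> to a coset of \<open>W\<close>.\<close>

definition M where "M s = \<alpha> * \<rho> s + \<rho>' (\<alpha> * s)"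
definition N where "N s w = - (s * \<sigma> w) + \<alpha> * \<rho> w + \<rho>' (\<alpha> * w)"
definition G where "G s w = tr (s * w * \<sigma> w + \<alpha> * w * \<rho> w)"
definition f where "f x = tr (x * x * \<sigma> x - x * \<sigma> x * \<sigma> x + \<alpha> * x * \<rho> x)"

lemma M_add: "M (s + t) = M s + M t"
  by (simp add: M_def \<rho>_add \<rho>'_add distrib_left)

lemma N_add: "N s (w + u) = N s w + N s u"
  by (simp add: N_def \<sigma>_add \<rho>_add \<rho>'_add distrib_left)

lemma M_mem: "s \<in> A \<Longrightarrow> M s \<in> E"
  by (simp add: M_def A_def E_def \<sigma>_add \<sigma>_mult \<sigma>_\<rho> \<sigma>_\<rho>' \<alpha>)

lemma N_mem: "s \<in> A \<Longrightarrow> w \<in> W \<Longrightarrow> N s w \<in> W"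
  by (simp add: N_def A_def W_def \<sigma>_add \<sigma>_mult \<sigma>_\<rho> \<sigma>_\<rho>' \<alpha>)

lemma \<rho>_eq_uminus: "\<rho>' x = - x \<Longrightarrow> \<rho> x = - x"
  by (metis \<rho>_\<rho>' \<rho>_simps(2) minus_minus)

text \<open>Multiplying \<open>M s = 0\<close> by \<open>s\<close> shows that
  \<open>\<alpha> * s * \<rho> s\<close> is negated by \<open>\<rho>\<close>. It is also negated by
  \<open>\<sigma>\<close>, being a product of three factors from \<open>A\<close>, so
  \<open>no_common_anti\<close> applies.\<close>

lemma M_eq_0:
  assumes s: "s \<in> A" and "M s = 0"
  shows "s = 0"
proof -
  let ?e = "\<alpha> * s * \<rho> s"
  have "s * M s = ?e + \<rho>' ?e"
    by (simp add: M_def \<rho>'_mult \<rho>'_\<rho> algebra_simps)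
  then have "?e + \<rho>' ?e = 0" using assms(2) by simp
  then have "\<rho>' ?e = - ?e" by (metis eq_neg_iff_add_eq_0 add.commute)
  moreover have "\<sigma> ?e = - ?e"
    using s by (simp add: A_def \<sigma>_mult \<sigma>_\<rho> \<alpha>)
  ultimately have "?e = 0"
    using no_common_anti \<rho>_eq_uminus by blast
  then show ?thesis using \<alpha> by (simp add: \<rho>_eq_0_iff)
qed

text \<open>Multiplying \<open>N s w = 0\<close> by \<open>w\<close> writes a
  \<open>\<sigma>\<close>-invariant element as \<open>?e + \<rho>' ?e\<close>. Then
  \<open>?e - \<sigma> ?e\<close> is negated by both \<open>\<sigma>\<close> and
  \<open>\<rho>\<close>, hence zero, and \<open>?e\<close> itself is
  \<open>\<sigma>\<close>-invariant.\<close>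

lemma N_eq_0:
  assumes s: "s \<in> A" and w: "w \<in> W" and "N s w = 0"
  shows "w = 0"
proof (rule ccontr)
  assume nz: "w \<noteq> 0"
  let ?e = "\<alpha> * w * \<rho> w"
  let ?c = "s * w * \<sigma> w"
  have [simp]: "\<sigma> (\<sigma> w) = - w" "\<sigma> s = - s" using s w by (simp_all add: A_def W_def)
  have "w * N s w = - ?c + ?e + \<rho>' ?e"
    by (simp add: N_def \<rho>'_mult \<rho>'_\<rho> algebra_simps)
  then have e: "?e + \<rho>' ?e = ?c" using assms(3) by (simp add: algebra_simps)
  have "\<sigma> ?c = ?c" by (simp add: \<sigma>_mult)
  have "\<sigma> ?e + \<rho>' (\<sigma> ?e) = \<sigma> (?e + \<rho>' ?e)" by (simp only: \<sigma>_add \<sigma>_\<rho>')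
  also have "\<dots> = ?e + \<rho>' ?e" unfolding e by fact
  finally have "\<sigma> ?e + \<rho>' (\<sigma> ?e) = ?e + \<rho>' ?e" .
  then have "\<rho>' (?e - \<sigma> ?e) = - (?e - \<sigma> ?e)"
    unfolding \<rho>'_simps by (simp add: algebra_simps)
  moreover have "\<sigma> (?e - \<sigma> ?e) = - (?e - \<sigma> ?e)"
    by (simp add: \<sigma>_add \<sigma>_mult \<sigma>_\<rho> \<alpha>)
  ultimately have "?e - \<sigma> ?e = 0"
    using no_common_anti \<rho>_eq_uminus by blast
  then have "\<alpha> * (w * \<rho> w) = \<alpha> * (- (\<sigma> w * \<rho> (\<sigma> w)))"
    by (simp add: \<sigma>_mult \<sigma>_\<rho> \<alpha> mult.assoc eq_neg_iff_add_eq_0)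
  then have "w * \<rho> w = - (\<sigma> w * \<rho> (\<sigma> w))" using \<alpha>(1) mult_left_cancel by blast
  then have e': "\<sigma> w * \<rho> (\<sigma> w) = - (w * \<rho> w)" by simp
  \<comment> \<open>In terms of this ratio, \<open>w \<in> W\<close> says
    \<open>g * \<sigma> g = - 1\<close>, and the invariance of \<open>?e\<close> says
    \<open>g * \<rho> g = - 1\<close>; \<open>no_common_norm\<close> excludes the
    combination.\<close>
  define g where "g = \<sigma> w / w"
  have g: "\<sigma> w = g * w" using nz by (simp add: g_def)
  have "g * \<sigma> g * w = \<sigma> (\<sigma> w)" using g by (metis \<sigma>_mult mult.commute mult.left_commute)
  then have "(g * \<sigma> g) * w = (- 1) * w" by simp
  then have 1: "g * \<sigma> g = - 1" using nz mult_right_cancel by blast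
  have "(g * \<rho> g) * (w * \<rho> w) = (- 1) * (w * \<rho> w)"
    using e' unfolding g \<rho>_mult by (simp add: algebra_simps)
  then have "g * \<rho> g = - 1" using nz mult_right_cancel no_zero_divisors \<rho>_eq_0_iff by metis
  with no_common_norm[OF 1] show False by simp
qed

lemma inj_on_M: "inj_on M A"
proof (rule inj_onI)
  fix s t assume *: "s \<in> A" "t \<in> A" "M s = M t"
  have "M (s - t) + M t = M s" by (simp flip: M_add)
  then have "M (s - t) = 0" using * by simp
  then have "s - t = 0" using M_eq_0 add_subgroupD(2)[OF add_subgroups(2)] * by blast
  then show "s = t" by simp
qed

lemma inj_on_N:
  assumes s: "s \<in> A"
  shows "inj_on (N s) W"
proof (rule inj_onI)
  fix w u assume *: "w \<in> W" "u \<in> W" "N s w = N s u"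
  have "N s (w - u) + N s u = N s w" by (simp flip: N_add)
  then have "N s (w - u) = 0" using * by simp
  then have "w - u = 0" using N_eq_0[OF s] add_subgroupD(2)[OF add_subgroups(3)] * by blast
  then show "w = u" by simp
qed

text \<open>Multiplication by \<open>\<alpha>\<close> maps each of the two subspaces injectively
  into the other.\<close>

lemma card_A_eq_card_E: "card A = card E"
proof (rule antisym)
  show "card A \<le> card E" "card E \<le> card A"
    by (rule card_inj_on_le[where f = "(*) \<alpha>"];
        auto simp: inj_on_def A_def E_def \<sigma>_mult \<alpha>)+
qed

lemma bij_betw_M: "bij_betw M A E"
proof -
  have "M ` A \<subseteq> E" using M_mem by auto
  then show ?thesis
    by (simp add: bij_betw_def card_image card_subset_eq inj_on_M card_A_eq_card_E)
qed

lemma bij_betw_N: "s \<in> A \<Longrightarrow> bij_betw (N s) W W"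
  using N_mem by (simp add: bij_betw_def endo_inj_surj image_subsetI inj_on_N)

text \<open>The adjoint of multiplying by \<open>\<alpha>\<close> after \<open>\<rho>\<close>
  accounts for the term with \<open>\<rho>'\<close> in \<open>N\<close>. The two mixed terms from
  \<open>s * w * \<sigma> w\<close> have equal traces.\<close>

lemma G_add:
  assumes s: "s \<in> A" and "w \<in> W" "u \<in> W"
  shows "G s (w + u) = G s w + G s u + tr (w * N s u)"
proof -
  have [simp]: "\<sigma> (\<sigma> w) = - w" "\<sigma> (\<sigma> u) = - u" "\<sigma> s = - s" using assms by (simp_all add: A_def W_def)
  have 1: "tr (s * u * \<sigma> w) = tr (s * w * \<sigma> u)"
    using tr_\<sigma>[of "s * w * \<sigma> u"] by (simp add: \<sigma>_mult algebra_simps)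
  have 2: "tr (\<alpha> * u * \<rho> w) = tr (w * \<rho>' (\<alpha> * u))"
    using tr_\<rho>'[of "\<alpha> * u * \<rho> w"] by (simp add: \<rho>'_mult \<rho>'_\<rho> algebra_simps)
  \<comment> \<open>Doubling is negation modulo 3; hence the minus sign in front of
    \<open>s * \<sigma> w\<close> in \<open>N\<close>.\<close>
  have 3: "tr x + tr x = - tr x" for x
    unfolding tr_add[symmetric] double_eq by simp
  have "G s (w + u) = G s w + G s u + (tr (s * w * \<sigma> u) + tr (s * u * \<sigma> w)) + tr (\<alpha> * w * \<rho> u) + tr (\<alpha> * u * \<rho> w)"
    by (simp add: G_def \<sigma>_add \<rho>_add distrib_left distrib_right tr_add)
  also have "\<dots> = G s w + G s u + tr (w * N s u)"
    unfolding 1 2 3 by (simp add: N_def tr_add algebra_simps)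
  finally show ?thesis .
qed

text \<open>The cubic part is the trace of \<open>x * \<sigma> x * (x - \<sigma> x)\<close>.
  Expanded along the splitting, all of it except \<open>s * w * \<sigma> w\<close> has trace zero,
  and the quadratic part retains only the products within \<open>W\<close> and between
  \<open>E\<close> and \<open>A\<close>.\<close>

lemma f_decomposed:
  assumes "v \<in> E" "s \<in> A" "w \<in> W"
  shows "f (v + s + w) = G s w + tr (v * M s)"
proof -
  have [simp]: "\<sigma> v = v" "\<sigma> s = - s" "\<sigma> (\<sigma> w) = - w"
    using assms by (auto simp: E_def A_def W_def)
  define x where "x = v + s + w"
  have \<sigma>x: "\<sigma> x = v - s + \<sigma> w" by (simp add: x_def \<sigma>_add)
  \<comment> \<open>This is the component of \<open>x - \<sigma> x\<close> outside
    \<open>W\<close>.\<close>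
  define t where "t = 2 * s"
  have [simp]: "\<sigma> t = - t" using \<sigma>_add[of s s] unfolding t_def mult_2 by simp
  \<comment> \<open>The terms are sorted by their degree in \<open>w\<close>: \<open>p\<close> has
    degree 0, \<open>y - \<sigma> y\<close> and \<open>4 * (s * w * \<sigma> w)\<close> have degree
    2, and \<open>r\<close> collects the odd degrees, which the square of \<open>\<sigma>\<close>
    negates.\<close>
  define p where "p = t * (v * v - s * s)"
  define y where "y = (v - s) * w * w"
  define r where "r = (v * v - s * s) * (w - \<sigma> w) + t * ((v + s) * \<sigma> w + (v - s) * w) + w * \<sigma> w * (w - \<sigma> w)"
  have "x * x * \<sigma> x - x * \<sigma> x * \<sigma> x = 4 * (s * w * \<sigma> w) + p + (y - \<sigma> y) + r"
    unfolding \<sigma>x by (simp add: x_def p_def y_def r_def t_def \<sigma>_add \<sigma>_mult algebra_simps)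
  moreover have "tr p = 0"
    by (rule tr_anti_\<sigma>) (simp add: p_def \<sigma>_mult)
  moreover have "tr (y - \<sigma> y) = 0" by (simp add: tr_\<sigma>)
  moreover have "tr r = 0"
    by (rule tr_anti_\<sigma>\<sigma>) (simp add: r_def \<sigma>_mult \<sigma>_add algebra_simps)
  ultimately have cubic_part: "tr (x * x * \<sigma> x - x * \<sigma> x * \<sigma> x) = tr (s * w * \<sigma> w)"
    by (simp add: tr_add four_mult del: tr_simps(3))
  have "tr (\<alpha> * v * \<rho> v) = 0" "tr (\<alpha> * s * \<rho> s) = 0"
    by (rule tr_anti_\<sigma>; simp add: \<sigma>_mult \<sigma>_\<rho> \<alpha>)+
  moreover have "tr (\<alpha> * v * \<rho> w) = 0" "tr (\<alpha> * s * \<rho> w) = 0" "tr (\<alpha> * w * \<rho> v) = 0" "tr (\<alpha> * w * \<rho> s) = 0"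
    by (rule tr_anti_\<sigma>\<sigma>; simp add: \<sigma>_mult \<sigma>_\<rho> \<alpha>)+
  moreover have "tr (\<alpha> * s * \<rho> v) = tr (v * \<rho>' (\<alpha> * s))"
    using tr_\<rho>'[of "\<alpha> * s * \<rho> v"] by (simp add: \<rho>'_mult \<rho>'_\<rho> algebra_simps)
  ultimately have "tr (\<alpha> * x * \<rho> x) = tr (\<alpha> * w * \<rho> w) + tr (v * M s)"
    unfolding x_def by (simp add: \<rho>_add distrib_left distrib_right tr_add M_def mult.left_commute mult.assoc)
  then show ?thesis
    using cubic_part by (simp add: f_def G_def x_def tr_add del: tr_simps(3))
qed

definition tr_form where "tr_form x y = tr (x * y)"

theorem bent_f: "bent tr_form f"
proof (rule bent_if_quadratic_fibres[where V = E and S = A and W = W and Q = G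
      and b = "\<lambda>v s. tr (v * M s)" and c = "\<lambda>s w u. tr (w * N s u)"])
  show "\<exists>s\<in>A. tr (v * M s) \<noteq> 0" if "v \<in> E" "v \<noteq> 0" for v
    using tr_nondegenerate_on(1)[OF that] bij_betw_M
    by (metis bij_betw_imp_surj_on imageE mult.commute)
  show "\<exists>v\<in>E. tr (v * M s) \<noteq> 0" if "s \<in> A" "s \<noteq> 0" for s
    using tr_nondegenerate_on(1)[OF M_mem] M_eq_0 that by blast
  show "\<exists>w\<in>W. tr (w * N s u) \<noteq> 0" if "s \<in> A" "u \<in> W" "u \<noteq> 0" for s u
    using tr_nondegenerate_on(3)[OF N_mem] N_eq_0 that by blast
qed (simp_all add: tr_form_def tr_add distrib_left distrib_right M_add f_decomposed G_add add_subgroups decompose)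

end

section \<open>Walsh transform, signs and dual of \<open>f\<close>\<close>

context quartic_setting
begin

definition \<Gamma> where "\<Gamma> s = (\<Sum>w\<in>W. omega_pow (G s w))"
definition sol where "sol e = inv_into A M e"
text \<open>The centre of the quadratic function \<open>G s u - tr (u * w)\<close> of
  \<open>u\<close>: translating by it absorbs the linear term.\<close>

definition ctr where "ctr s w = inv_into W (N s) w"
text \<open>The exponent left over once the sum over \<open>E\<close> has forced
  \<open>s = sol (prE y)\<close> and the square on \<open>W\<close> has been completed;
  \<open>dual_f\<close> identifies it with the dual.\<close>

definition f_dual where "f_dual y = - tr (sol (prE y) * y) - G (sol (prE y)) (ctr (sol (prE y)) (prW y))"

lemma zero_mem [simp]: "0 \<in> E" "0 \<in> A" "0 \<in> W"
  by (simp_all add: E_def A_def W_def)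

lemma add_mem [simp]:
  "x \<in> E \<Longrightarrow> y \<in> E \<Longrightarrow> x + y \<in> E" "x \<in> A \<Longrightarrow> y \<in> A \<Longrightarrow> x + y \<in> A" "x \<in> W \<Longrightarrow> y \<in> W \<Longrightarrow> x + y \<in> W"
  by (simp_all add: E_def A_def W_def \<sigma>_add)

lemma uminus_mem [simp]: "x \<in> W \<Longrightarrow> - x \<in> W"
  by (simp add: W_def)

lemma pr_id [simp]: "e \<in> E \<Longrightarrow> prE e = e" "e \<in> E \<Longrightarrow> prW e = 0"
  using pr_of_sum[of e 0 0] by simp_all

lemma sol [simp]: "e \<in> E \<Longrightarrow> sol e \<in> A" "e \<in> E \<Longrightarrow> M (sol e) = e" "s \<in> A \<Longrightarrow> sol (M s) = s"
  unfolding sol_def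
  by (rule bij_betwE[OF bij_betw_inv_into[OF bij_betw_M], rule_format], assumption)
     (rule bij_betw_inv_into_right[OF bij_betw_M] bij_betw_inv_into_left[OF bij_betw_M], assumption)+

lemma ctr:
  assumes "s \<in> A" "w \<in> W"
  shows "ctr s w \<in> W" "N s (ctr s w) = w" "ctr s (N s w) = w"
proof -
  note bij = bij_betw_N[OF assms(1)]
  show "ctr s w \<in> W" using bij_betwE[OF bij_betw_inv_into[OF bij]] assms(2) by (simp add: ctr_def)
  show "N s (ctr s w) = w" using bij_betw_inv_into_right[OF bij assms(2)] by (simp add: ctr_def)
  show "ctr s (N s w) = w" using bij_betw_inv_into_left[OF bij assms(2)] by (simp add: ctr_def)
qed

lemma G_0 [simp]: "G s 0 = 0" and G_minus [simp]: "G s (- w) = G s w"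
  by (simp_all add: G_def)

lemma N_minus [simp]: "N s (- w) = - N s w"
  by (simp add: N_def)

lemma M_0 [simp]: "M 0 = 0"
  by (simp add: M_def)

lemma sum_E:
  assumes "e \<in> E"
  shows "(\<Sum>v\<in>E. omega_pow (c + tr (v * e))) = (if e = 0 then of_nat (card E) * omega_pow c else 0)"
proof (cases "e = 0")
  case False
  then obtain v where v: "v \<in> E" "tr (v * e) \<noteq> 0" using tr_nondegenerate_on(1)[OF assms] by blast
  have "(\<Sum>v\<in>E. omega_pow (c + tr (v * e))) = 0"
    by (rule sum_character_eq_0[OF add_subgroups(1), where g = "\<lambda>v. tr (v * e)" and h = v])
       (use v in \<open>simp_all add: distrib_right tr_add\<close>)
  then show ?thesis using False by simp
qed simp

lemma complete_square:
  assumes "s \<in> A" "w \<in> W" "u \<in> W"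
  shows "G s w - tr (w * N s u) = G s (w + - u) - G s u"
proof -
  have "G s (w + - u) = G s w + G s u + - tr (w * N s u)"
    using G_add[OF assms(1,2) uminus_mem[OF assms(3)]]
    by (simp only: G_minus N_minus mult_minus_right tr_simps)
  then show ?thesis by (simp only: add_diff_cancel_right' add.commute[of "G s u"] add.left_commute add.assoc diff_conv_add_uminus add_0_right right_minus add_0_left)
qed

text \<open>For fixed \<open>s\<close> and \<open>w\<close> the sum over \<open>E\<close> is a
  character sum that vanishes unless \<open>M s = prE y\<close>. For the one remaining
  \<open>s\<close>, completing the square turns the sum over \<open>W\<close> into a translate of
  the Gauss sum \<open>\<Gamma> s\<close>.\<close>

lemma walsh_f:
  "walsh tr_form f y = of_nat (card E) * omega_pow (f_dual y) * \<Gamma> (sol (prE y))"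
proof -
  \<comment> \<open>All terms of the exponent that do not involve \<open>v\<close>.\<close>
  define c where "c s w = G s w - tr (s * y) - tr (w * y)" for s w
  have "walsh tr_form f y = (\<Sum>x\<in>UNIV. omega_pow (f x - tr (x * y)))"
    by (simp add: walsh_def tr_form_def)
  also have "\<dots> = (\<Sum>z\<in>E \<times> A \<times> W. omega_pow (f (case z of (v, s, w) \<Rightarrow> v + s + w) - tr ((case z of (v, s, w) \<Rightarrow> v + s + w) * y)))"
    by (rule sum.reindex_bij_betw[OF bij_betw_decomposition, of "\<lambda>x. omega_pow (f x - tr (x * y))", symmetric])
  also have "\<dots> = (\<Sum>(v, s, w)\<in>E \<times> A \<times> W. omega_pow (c s w + tr (v * (M s - prE y))))"
  proof (intro sum.cong refl, clarify)
    fix v s w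
    assume vsw: "v \<in> E" "s \<in> A" "w \<in> W"
    have "tr ((v + s + w) * y) = tr (v * prE y) + tr (s * y) + tr (w * y)"
      by (simp only: distrib_right tr_add tr_mult_pr(1)[OF vsw(1), of y])
    then have "f (v + s + w) - tr ((v + s + w) * y) = c s w + tr (v * (M s - prE y))"
      unfolding f_decomposed[OF vsw] by (simp add: c_def right_diff_distrib)
    then show "omega_pow (f (v + s + w) - tr ((v + s + w) * y)) = omega_pow (c s w + tr (v * (M s - prE y)))"
      by (rule arg_cong)
  qed
  also have "\<dots> = (\<Sum>v\<in>E. \<Sum>s\<in>A. \<Sum>w\<in>W. omega_pow (c s w + tr (v * (M s - prE y))))"
    by (simp add: sum.cartesian_product)
  also have "\<dots> = (\<Sum>s\<in>A. \<Sum>v\<in>E. \<Sum>w\<in>W. omega_pow (c s w + tr (v * (M s - prE y))))"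
    by (rule sum.swap)
  also have "\<dots> = (\<Sum>s\<in>A. \<Sum>w\<in>W. \<Sum>v\<in>E. omega_pow (c s w + tr (v * (M s - prE y))))"
    by (intro sum.cong refl sum.swap)
  also have "\<dots> = (\<Sum>s\<in>A. \<Sum>w\<in>W. if s = sol (prE y) then of_nat (card E) * omega_pow (c s w) else 0)"
  proof (intro sum.cong refl)
    fix s w assume "s \<in> A"
    then have "M s - prE y = 0 \<longleftrightarrow> s = sol (prE y)" using sol(3)[of s] by (metis diff_eq_diff_eq diff_self eq_iff_diff_eq_0 pr_mem(1) sol(2))
    moreover have "M s - prE y \<in> E"
      using \<open>s \<in> A\<close> add_subgroupD(2)[OF add_subgroups(1)] M_mem by simp
    ultimately show "(\<Sum>v\<in>E. omega_pow (c s w + tr (v * (M s - prE y)))) =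
        (if s = sol (prE y) then of_nat (card E) * omega_pow (c s w) else 0)"
      by (simp add: sum_E)
  qed
  also have "\<dots> = (\<Sum>s\<in>A. if s = sol (prE y) then (\<Sum>w\<in>W. of_nat (card E) * omega_pow (c s w)) else 0)"
    by (intro sum.cong refl) auto
  also have "\<dots> = (\<Sum>w\<in>W. of_nat (card E) * omega_pow (c (sol (prE y)) w))"
    by (simp add: sum.delta)
  also have "\<dots> = of_nat (card E) * omega_pow (f_dual y) * (\<Sum>w\<in>W. omega_pow (G (sol (prE y)) (w + - ctr (sol (prE y)) (prW y))))"
    unfolding sum_distrib_left
  proof (intro sum.cong refl)
    fix w assume w: "w \<in> W"
    define s where "s = sol (prE y)"
    have s: "s \<in> A" by (simp add: s_def)
    note u = ctr[OF s pr_mem(3)[of y]]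
    have "tr (w * y) = tr (w * N s (ctr s (prW y)))" unfolding u(2) by (rule tr_mult_pr(3)[OF w])
    then have "c s w = f_dual y + G s (w + - ctr s (prW y))"
      using complete_square[OF s w u(1)] by (simp add: c_def f_dual_def algebra_simps flip: s_def)
    then show "of_nat (card E) * omega_pow (c (sol (prE y)) w) =
       of_nat (card E) * omega_pow (f_dual y) * omega_pow (G (sol (prE y)) (w + - ctr (sol (prE y)) (prW y)))"
      unfolding s_def[symmetric] by (simp add: omega_pow_add)
  qed
  also have "(\<Sum>w\<in>W. omega_pow (G (sol (prE y)) (w + - ctr (sol (prE y)) (prW y)))) = \<Gamma> (sol (prE y))"
    unfolding \<Gamma>_def by (rule sum_translate[OF add_subgroups(3)]) (simp add: ctr)
  finally show ?thesis .
qed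

lemma card_UNIV_eq: "CARD('a) = card E * card E * card W"
  using bij_betw_same_card[OF bij_betw_decomposition] by (simp add: card_cartesian_product card_A_eq_card_E)

lemma nonempty [simp]: "E \<noteq> {}" "W \<noteq> {}"
  using zero_mem by blast+

text \<open>Bentness, read at \<open>y = M s\<close>, where the Gauss sum that occurs is the one for
  \<open>s\<close>.\<close>

lemma norm_\<Gamma>:
  assumes "s \<in> A"
  shows "cmod (\<Gamma> s) = sqrt (real (card W))"
proof -
  have "(cmod (walsh tr_form f (M s)))\<^sup>2 = real (card E * card E * card W)"
    using bent_f by (simp only: bent_def card_UNIV_eq)
  then have "(cmod (\<Gamma> s))\<^sup>2 = real (card W)"
    using assms M_mem by (simp add: walsh_f norm_mult power_mult_distrib power2_eq_square)
  then show ?thesis by (metis norm_ge_zero real_sqrt_unique)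
qed

text \<open>The substitution of \<open>(w + u, w - u)\<close> for \<open>(w, u)\<close> turns \<open>G s w + G s u\<close> into
  \<open>2 * (G s w + G s u)\<close>, which is its negative modulo 3.\<close>

lemma \<Gamma>_squared_real:
  assumes s: "s \<in> A"
  shows "cnj ((\<Gamma> s)\<^sup>2) = (\<Gamma> s)\<^sup>2"
proof -
  have "cnj ((\<Gamma> s)\<^sup>2) = (\<Sum>w\<in>W. \<Sum>u\<in>W. omega_pow (- G s w + - G s u))"
    by (simp only: \<Gamma>_def power2_eq_square sum_product complex_cnj_mult cnj_sum cnj_omega_pow omega_pow_add)
  also have "\<dots> = (\<Sum>(w, u)\<in>W \<times> W. omega_pow (- G s w + - G s u))"
    by (rule sum.cartesian_product)
  also have "\<dots> = (\<Sum>(w, u)\<in>W \<times> W. omega_pow (G s w + G s u))"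
  \<comment> \<open>Applying the substitution twice multiplies by 2, that is by -1, so its inverse
    is its negative.\<close>
  proof (rule sum.reindex_bij_witness[where j = "\<lambda>(w, u). (w + u, w + - u)" and i = "\<lambda>(w, u). (- (w + u), - (w + - u))"])
    fix z assume "z \<in> W \<times> W"
    then obtain w u where z: "z = (w, u)" "w \<in> W" "u \<in> W" by auto
    have 1: "- (w + u + (w + - u)) = w" "- (w + u + - (w + - u)) = u"
      using double_eq[of w] double_eq[of u] by (simp_all add: algebra_simps)
    have 2: "- (w + u) + - (w + - u) = w" "- (w + u) + - (- (w + - u)) = u"
      using double_eq[of w] double_eq[of u] by (simp_all add: algebra_simps)
    show "(case case z of (w, u) \<Rightarrow> (w + u, w + - u) of (w, u) \<Rightarrow> (- (w + u), - (w + - u))) = z"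
      unfolding z prod.case 1 ..
    show "(case case z of (w, u) \<Rightarrow> (- (w + u), - (w + - u)) of (w, u) \<Rightarrow> (w + u, w + - u)) = z"
      unfolding z prod.case 2 ..
    show "(case z of (w, u) \<Rightarrow> (w + u, w + - u)) \<in> W \<times> W"
      "(case z of (w, u) \<Rightarrow> (- (w + u), - (w + - u))) \<in> W \<times> W"
      unfolding z prod.case using z by (simp_all only: mem_Sigma_iff add_mem uminus_mem)
    have 3: "a + a = - a" for a :: F3 by (cases a rule: F3_cases) (simp_all add: F3_numerals)
    have 4: "G s (w + - u) = G s w + G s u - tr (w * N s u)"
      using complete_square[OF s z(2,3)] by (simp add: algebra_simps)
    have "G s (w + u) + G s (w + - u) = (G s w + G s w) + (G s u + G s u)"
      unfolding G_add[OF s z(2,3)] 4 by simp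
    then show "(case case z of (w, u) \<Rightarrow> (w + u, w + - u) of (w, u) \<Rightarrow> omega_pow (G s w + G s u)) =
       (case z of (w, u) \<Rightarrow> omega_pow (- G s w + - G s u))"
      unfolding z prod.case 3 by simp
  qed
  also have "\<dots> = (\<Sum>w\<in>W. \<Sum>u\<in>W. omega_pow (G s w + G s u))"
    by (rule sum.cartesian_product[symmetric])
  also have "\<dots> = (\<Gamma> s)\<^sup>2"
    by (simp add: \<Gamma>_def power2_eq_square sum_product omega_pow_add)
  finally show ?thesis .
qed

definition \<epsilon> where "\<epsilon> s = \<Gamma> s / of_real (sqrt (real (card W)))"

lemma card_W_gt_1: "card W > 1"
proof -
  obtain w where "w \<noteq> 0" "w \<in> W" using W_nontrivial by (auto simp: W_def)
  then have "card {0, w} \<le> card W" by (intro card_mono) auto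
  then show ?thesis using \<open>w \<noteq> 0\<close> by simp
qed

text \<open>The square is real and of modulus 1, so the fourth power is 1.\<close>

lemma \<epsilon>_cases:
  assumes "s \<in> A"
  shows "\<epsilon> s \<in> {1, -1, \<i>, -\<i>}"
proof -
  have norm: "cmod (\<epsilon> s) = 1"
    using norm_\<Gamma>[OF assms] by (simp add: \<epsilon>_def norm_divide)
  have "cnj ((\<epsilon> s)\<^sup>2) = (\<epsilon> s)\<^sup>2"
    using \<Gamma>_squared_real[OF assms] by (simp add: \<epsilon>_def power_divide)
  then have "(\<epsilon> s)\<^sup>2 * (\<epsilon> s)\<^sup>2 = (\<epsilon> s)\<^sup>2 * cnj ((\<epsilon> s)\<^sup>2)" by simp
  also have "\<dots> = 1"
    unfolding complex_norm_square[symmetric] by (simp add: norm_power norm)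
  finally have "((\<epsilon> s - 1) * (\<epsilon> s + 1)) * ((\<epsilon> s - \<i>) * (\<epsilon> s + \<i>)) = 0"
    by (simp add: algebra_simps power2_eq_square)
  then show ?thesis by (auto simp: eq_neg_iff_add_eq_0)
qed

lemma normalized_walsh_f: "normalized_walsh tr_form f y = \<epsilon> (sol (prE y)) * omega_pow (f_dual y)"
proof -
  have "sqrt (real CARD('a)) = real (card E) * sqrt (real (card W))"
    unfolding card_UNIV_eq by (simp add: real_sqrt_mult)
  then show ?thesis
    by (simp add: normalized_walsh_def walsh_f \<epsilon>_def)
qed

lemma dual_f: "dual tr_form f = f_dual"
proof
  fix y
  show "dual tr_form f y = f_dual y"
    unfolding dual_def normalized_walsh_f
  proof (rule the_equality)
    show "\<exists>\<epsilon>'\<in>{1, - 1, \<i>, - \<i>}. \<epsilon> (sol (prE y)) * omega_pow (f_dual y) = \<epsilon>' * omega_pow (f_dual y)"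
      using \<epsilon>_cases[of "sol (prE y)"] by auto
    show "c = f_dual y" if "\<exists>\<epsilon>'\<in>{1, - 1, \<i>, - \<i>}. \<epsilon> (sol (prE y)) * omega_pow (f_dual y) = \<epsilon>' * omega_pow c" for c
      using that omega_pow_inject_upto_unit[OF _ \<epsilon>_cases[of "sol (prE y)"]] by (metis pr_mem(1) sol(1))
  qed
qed

text \<open>After exchanging the sums, each \<open>w\<close> contributes a character sum over
  \<open>A\<close> with frequency \<open>w * \<sigma> w\<close>. This is an element of
  \<open>A\<close> that vanishes only for \<open>w = 0\<close>.\<close>

lemma sum_\<Gamma>: "(\<Sum>s\<in>A. \<Gamma> s) = of_nat (card A)"
proof -
  have "(\<Sum>s\<in>A. \<Gamma> s) = (\<Sum>w\<in>W. \<Sum>s\<in>A. omega_pow (tr (\<alpha> * w * \<rho> w) + tr (s * (w * \<sigma> w))))"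
    unfolding \<Gamma>_def G_def tr_add by (subst sum.swap) (simp add: mult.assoc add.commute)
  also have "\<dots> = (\<Sum>w\<in>W. if w = 0 then of_nat (card A) else 0)"
  proof (intro sum.cong refl)
    fix w assume w: "w \<in> W"
    show "(\<Sum>s\<in>A. omega_pow (tr (\<alpha> * w * \<rho> w) + tr (s * (w * \<sigma> w)))) = (if w = 0 then of_nat (card A) else 0)"
    proof (cases "w = 0")
      case False
      have "w * \<sigma> w \<in> A" using w by (simp add: A_def W_def \<sigma>_mult)
      moreover have "w * \<sigma> w \<noteq> 0" using False by (simp add: \<sigma>_eq_0_iff)
      ultimately obtain s where s: "s \<in> A" "tr (s * (w * \<sigma> w)) \<noteq> 0"
        using tr_nondegenerate_on(2) by blast
      have "(\<Sum>s\<in>A. omega_pow (tr (\<alpha> * w * \<rho> w) + tr (s * (w * \<sigma> w)))) = 0"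
        by (rule sum_character_eq_0[OF add_subgroups(2), where g = "\<lambda>s. tr (s * (w * \<sigma> w))" and h = s])
           (use s in \<open>simp_all add: distrib_right tr_add\<close>)
      then show ?thesis using False by simp
    qed simp
  qed
  also have "\<dots> = of_nat (card A)" by simp
  finally show ?thesis .
qed

theorem not_weakly_regular_f: "\<not> weakly_regular tr_form f"
proof
  assume "weakly_regular tr_form f"
  then obtain u where u: "cmod u = 1" "\<And>y. normalized_walsh tr_form f y = u * omega_pow (f_dual y)"
    by (auto simp: weakly_regular_def dual_f)
  \<comment> \<open>Every \<open>s \<in> A\<close> occurs as \<open>sol (prE y)\<close>, namely for
    \<open>y = M s\<close>, so one constant \<open>u\<close> controls all the signs.\<close>
  have \<epsilon>: "\<epsilon> s = u" if "s \<in> A" for s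
    using u(2)[of "M s"] that M_mem by (simp add: normalized_walsh_f)
  have "\<Gamma> s = u * of_real (sqrt (real (card W)))" if "s \<in> A" for s
    unfolding \<epsilon>[OF that, symmetric] by (simp add: \<epsilon>_def)
  then have "of_nat (card A) * (u * of_real (sqrt (real (card W)))) = of_nat (card A)"
    using sum_\<Gamma> by simp
  then have "u * of_real (sqrt (real (card W))) = 1"
    using card_A_eq_card_E by simp
  then have "cmod u * sqrt (real (card W)) = 1"
    by (metis norm_mult norm_of_real abs_of_nonneg norm_one of_nat_0_le_iff real_sqrt_ge_0_iff)
  then show False using u(1) card_W_gt_1 by simp
qed

lemma sol_add:
  assumes "e \<in> E" "e' \<in> E"
  shows "sol (e + e') = sol e + sol e'"
  using sol(3)[of "sol e + sol e'"] assms by (simp add: M_add)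

lemma ctr_add:
  assumes "s \<in> A" "w \<in> W" "u \<in> W"
  shows "ctr s (w + u) = ctr s w + ctr s u"
  using ctr(3)[of s "ctr s w + ctr s u"] assms by (simp add: N_add ctr)

text \<open>\<open>f_dual\<close> is again quadratic on cosets of \<open>W\<close>, now with
  \<open>E\<close> as parameter space and \<open>A\<close> as the linear direction. Since
  \<open>N s (ctr s u) = u\<close>, the polar form of \<open>G s\<close> taken at centres is
  \<open>tr (ctr s w * u)\<close>.\<close>

theorem dual_bent_f: "dual_bent tr_form f"
  unfolding dual_bent_def dual_f
proof
  show "bent tr_form f_dual"
  proof (rule bent_if_quadratic_fibres[where V = A and S = E and W = W
        and Q = "\<lambda>e w. - G (sol e) (ctr (sol e) w)" and b = "\<lambda>s e. - tr (sol e * s)"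
        and c = "\<lambda>e w u. - tr (ctr (sol e) w * u)"])
    show "\<exists>v\<in>A. \<exists>s\<in>E. \<exists>w\<in>W. x = v + s + w" for x
      using decompose[of x] by (metis add.commute)
    show "f_dual (v + s + w) = - G (sol s) (ctr (sol s) w) + - tr (sol s * v)"
      if "v \<in> A" "s \<in> E" "w \<in> W" for v s w
    proof -
      have "tr (sol s * (s + v + w)) = tr (sol s * v)"
        using that by (subst tr_mult_pr(2)) (simp_all add: pr_of_sum)
      then show ?thesis
        using pr_of_sum[OF that(2,1,3)] by (simp add: f_dual_def add.commute[of v s])
    qed
    show "\<exists>e\<in>E. - tr (sol e * v) \<noteq> 0" if "v \<in> A" "v \<noteq> 0" for v
      using tr_nondegenerate_on(2)[OF that] M_mem sol(3) by (metis neg_equal_0_iff_equal)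
    show "\<exists>v\<in>A. - tr (sol e * v) \<noteq> 0" if "e \<in> E" "e \<noteq> 0" for e
      using tr_nondegenerate_on(2)[of "sol e"] sol(1,2)[OF that(1)] M_0 that
      by (metis neg_equal_0_iff_equal mult.commute)
    show "\<exists>w\<in>W. - tr (ctr (sol e) w * u) \<noteq> 0" if "e \<in> E" "u \<in> W" "u \<noteq> 0" for e u
      using tr_nondegenerate_on(3)[OF that(2,3)] N_mem ctr(3) sol(1)[OF that(1)]
      by (metis neg_equal_0_iff_equal)
  qed (simp_all add: tr_form_def tr_add distrib_left distrib_right sol_add ctr_add ctr G_add add_subgroups)
qed (rule bent_f)

text \<open>The first direction is \<open>\<alpha>\<close>, an element of \<open>A\<close>, and the
  other two lie in \<open>W\<close>. Then only the dependence of the polar form of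
  \<open>G s\<close> on \<open>s\<close> remains, and it is
  \<open>- tr (b * (\<alpha> * \<sigma> c))\<close>.\<close>

lemma third_difference_f:
  "\<exists>a b c. f (a + b + c) - f (a + b) - f (a + c) - f (b + c) + f a + f b + f c - f 0 \<noteq> 0"
proof -
  obtain c where c: "c \<noteq> 0" "c \<in> W" using W_nontrivial by (auto simp: W_def)
  have \<alpha>_mem: "\<alpha> \<in> A" using \<alpha> by (simp add: A_def)
  have "\<alpha> * \<sigma> c \<in> W" using c by (simp add: W_def \<sigma>_mult \<alpha>)
  moreover have "\<alpha> * \<sigma> c \<noteq> 0" using c \<alpha> by (simp add: \<sigma>_eq_0_iff)
  ultimately obtain b where b: "b \<in> W" "tr (b * (\<alpha> * \<sigma> c)) \<noteq> 0"
    using tr_nondegenerate_on(3) by blast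
  have fsw: "f (s + w) = G s w" if "s \<in> A" "w \<in> W" for s w
    using f_decomposed[of 0 s w] that by simp
  have fw: "f w = G 0 w" if "w \<in> W" for w
    using fsw[of 0 w] that by simp
  have fs: "f \<alpha> = 0" using fsw[of \<alpha> 0] \<alpha>_mem by simp
  have "f (\<alpha> + b + c) - f (\<alpha> + b) - f (\<alpha> + c) - f (b + c) + f \<alpha> + f b + f c - f 0
      = tr (b * N \<alpha> c) - tr (b * N 0 c)"
    using b c \<alpha>_mem by (simp add: add.assoc fsw fw fs G_add)
  also have "\<dots> = - tr (b * (\<alpha> * \<sigma> c))"
    by (simp add: N_def tr_add distrib_left right_diff_distrib)
  finally show ?thesis using b(2) by (metis neg_equal_0_iff_equal)
qed

end

section \<open>Algebraic degree and finite differences\<close>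

definition monomial :: "'v set \<Rightarrow> ('v \<Rightarrow> nat) \<Rightarrow> ('v \<Rightarrow> F3) \<Rightarrow> F3"
  where "monomial B e x = (\<Prod>b\<in>B. x b ^ e b)"

text \<open>Here \<open>x\<close> ranges over arbitrary coordinate assignments instead of vectors,
  which permits induction on the set \<open>B\<close> of variables.\<close>

definition poly_eval :: "'v set \<Rightarrow> (('v \<Rightarrow> nat) \<Rightarrow> F3) \<Rightarrow> ('v \<Rightarrow> F3) \<Rightarrow> F3"
  where "poly_eval B c x = (\<Sum>e\<in>anf_exponents B. c e * monomial B e x)"

lemma sum_anf_exponents_insert:
  assumes "b \<notin> B"
  shows "(\<Sum>e\<in>anf_exponents (insert b B). F e) =
    (\<Sum>e\<in>anf_exponents B. F (e(b := 0)) + F (e(b := 1)) + F (e(b := 2)))"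
proof -
  have three: "{0..2} = {0, 1, 2::nat}" by auto
  have "(\<Sum>e\<in>anf_exponents (insert b B). F e) =
      (\<Sum>z\<in>{0..2} \<times> anf_exponents B. F ((\<lambda>(i, e). e(b := i)) z))"
    unfolding anf_exponents_def PiE_insert_eq
    by (subst sum.reindex[OF inj_combinator[OF assms]]) (simp add: comp_def)
  also have "\<dots> = (\<Sum>i\<in>{0..2}. \<Sum>e\<in>anf_exponents B. F (e(b := i)))"
    unfolding sum.cartesian_product by (simp add: case_prod_beta)
  also have "\<dots> = (\<Sum>e\<in>anf_exponents B. F (e(b := 0)) + F (e(b := 1)) + F (e(b := 2)))"
    unfolding three by (simp add: sum.distrib add.assoc)
  finally show ?thesis .
qed

lemma monomial_insert:
  assumes "finite B" "b \<notin> B"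
  shows "monomial (insert b B) (e(b := i)) x = x b ^ i * monomial B e x"
proof -
  have "(\<Prod>a\<in>B. x a ^ (e(b := i)) a) = (\<Prod>a\<in>B. x a ^ e a)"
    by (rule prod.cong) (use assms in auto)
  then show ?thesis using assms by (simp add: monomial_def)
qed

lemma monomial_upd:
  assumes "b \<notin> B"
  shows "monomial B e (x(b := t)) = monomial B e x"
  unfolding monomial_def by (rule prod.cong) (use assms in auto)

lemma poly_eval_upd: "b \<notin> B \<Longrightarrow> poly_eval B c (x(b := t)) = poly_eval B c x"
  by (simp add: poly_eval_def monomial_upd)

lemma poly_eval_insert:
  assumes "finite B" "b \<notin> B"
  shows "poly_eval (insert b B) c x = poly_eval B (\<lambda>e. c (e(b := 0))) x
    + x b * poly_eval B (\<lambda>e. c (e(b := 1))) x + x b ^ 2 * poly_eval B (\<lambda>e. c (e(b := 2))) x"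
  using assms
  by (simp add: poly_eval_def sum_anf_exponents_insert monomial_insert sum.distrib sum_distrib_left mult.left_commute)

lemma F3_quadratic_eq_0:
  assumes "a + b = (0::F3)" "2 * a + 2 ^ 2 * b = 0"
  shows "a = 0" "b = 0"
  using assms by (cases a rule: F3_cases; cases b rule: F3_cases; simp add: F3_numerals)+

text \<open>Lagrange interpolation at the three points of the field, with the denominators reduced
  modulo 3.\<close>

lemma F3_interpolation:
  "q 0 + t * (q 2 - q 1) + t ^ 2 * - (q 0 + q 1 + q 2) = (q t :: F3)" for q :: "F3 \<Rightarrow> F3"
  by (cases t rule: F3_cases; cases "q 0" rule: F3_cases; cases "q 1" rule: F3_cases;
      cases "q 2" rule: F3_cases; simp add: F3_numerals)

lemma anf_exponents_insertE:
  assumes "e \<in> anf_exponents (insert b B)" "b \<notin> B"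
  obtains e' where "e' \<in> anf_exponents B" "e = e'(b := 0) \<or> e = e'(b := 1) \<or> e = e'(b := 2)"
proof -
  obtain i e' where e: "i \<in> {0..2::nat}" "e' \<in> anf_exponents B" "e = e'(b := i)"
    using assms(1) unfolding anf_exponents_def PiE_insert_eq by auto
  then have "i = 0 \<or> i = 1 \<or> i = 2" by auto
  with e that show thesis by blast
qed

text \<open>Uniqueness of the normal form. Evaluating one variable at 0, 1 and 2 makes its three
  coefficient polynomials vanish separately.\<close>

lemma poly_eval_eq_0_imp:
  assumes "finite B" "\<And>x. poly_eval B c x = 0" "e \<in> anf_exponents B"
  shows "c e = 0"
  using assms
proof (induction B arbitrary: c e)
  case empty
  then have "e = (\<lambda>_. undefined)" by (simp add: anf_exponents_def)
  with empty(1)[of "\<lambda>_. 0"] show ?case by (simp add: poly_eval_def anf_exponents_def monomial_def)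
next
  case (insert b B)
  let ?p = "\<lambda>i. poly_eval B (\<lambda>e. c (e(b := i)))"
  have eq: "?p 0 x + t * ?p 1 x + t ^ 2 * ?p 2 x = 0" for t x
    using insert.prems(1)[of "x(b := t)"] unfolding poly_eval_insert[OF insert.hyps]
    by (simp add: poly_eval_upd insert.hyps)
  have p0: "?p 0 x = 0" for x using eq[of x 0] by simp
  have p12: "?p 1 x + ?p 2 x = 0" "2 * ?p 1 x + 2 ^ 2 * ?p 2 x = 0" for x
    using eq[of x 1] eq[of x 2] unfolding p0 by (simp_all only: add_0_left mult_1 power_one)
  note * = p0 F3_quadratic_eq_0[OF p12]
  show ?case
    using anf_exponents_insertE[OF insert.prems(2) insert.hyps(2)]
      insert.IH[OF *(1)] insert.IH[OF *(2)] insert.IH[OF *(3)] by metis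
qed

text \<open>Interpolation in one variable expresses \<open>p\<close> through three functions of the
  remaining variables.\<close>

lemma poly_eval_exists:
  assumes "finite B" "\<And>x y. (\<And>b. b \<in> B \<Longrightarrow> x b = y b) \<Longrightarrow> p x = p y"
  shows "\<exists>c. \<forall>x. p x = poly_eval B c x"
  using assms
proof (induction B arbitrary: p)
  case empty
  have "p x = p (\<lambda>_. 0)" for x by (rule empty) simp
  then have "\<forall>x. p x = poly_eval {} (\<lambda>_. p (\<lambda>_. 0)) x"
    by (simp add: poly_eval_def anf_exponents_def monomial_def)
  then show ?case by blast
next
  case (insert b B)
  define q where "q t x = p (x(b := t))" for t x
  have q: "q t x = q t y" if "\<And>b. b \<in> B \<Longrightarrow> x b = y b" for t x y
    unfolding q_def
  proof (rule insert.prems)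
    show "(x(b := t)) b' = (y(b := t)) b'" if "b' \<in> insert b B" for b'
      using that \<open>\<And>b. b \<in> B \<Longrightarrow> x b = y b\<close> by (cases "b' = b") simp_all
  qed
  have "\<exists>c. \<forall>x. q 0 x = poly_eval B c x"
    by (rule insert.IH) (rule q)
  then obtain c0 where c0: "\<And>x. q 0 x = poly_eval B c0 x" by blast
  have "\<exists>c. \<forall>x. q 2 x - q 1 x = poly_eval B c x"
  proof (rule insert.IH)
    show "q 2 x - q 1 x = q 2 y - q 1 y" if "\<And>b. b \<in> B \<Longrightarrow> x b = y b" for x y
      by (simp only: q[of x y, OF that])
  qed
  then obtain c1 where c1: "\<And>x. q 2 x - q 1 x = poly_eval B c1 x" by blast
  have "\<exists>c. \<forall>x. - (q 0 x + q 1 x + q 2 x) = poly_eval B c x"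
  proof (rule insert.IH)
    show "- (q 0 x + q 1 x + q 2 x) = - (q 0 y + q 1 y + q 2 y)" if "\<And>b. b \<in> B \<Longrightarrow> x b = y b" for x y
      by (simp only: q[of x y, OF that])
  qed
  then obtain c2 where c2: "\<And>x. - (q 0 x + q 1 x + q 2 x) = poly_eval B c2 x" by blast
  \<comment> \<open>Exponent vectors over \<open>B\<close> are extensional, so the entry at
    \<open>b\<close> has to be reset to \<open>undefined\<close> before \<open>c0\<close>,
    \<open>c1\<close> or \<open>c2\<close> is consulted.\<close>
  define c where "c e = (let e' = e(b := undefined) in
    if e b = 0 then c0 e' else if e b = 1 then c1 e' else c2 e')" for e :: "'a \<Rightarrow> nat"
  have upd: "e(b := undefined) = e" if "e \<in> anf_exponents B" for e
    using that insert.hyps(2) by (auto simp: anf_exponents_def PiE_def extensional_def)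
  have "poly_eval B (\<lambda>e. c (e(b := 0))) x = q 0 x"
    "poly_eval B (\<lambda>e. c (e(b := 1))) x = q 2 x - q 1 x" for x
    unfolding c0 c1 poly_eval_def by (auto intro!: sum.cong simp: c_def upd)
  moreover have "poly_eval B (\<lambda>e. c (e(b := 2))) x = - (q 0 x + q 1 x + q 2 x)" for x
    unfolding c2 poly_eval_def by (rule sum.cong) (simp_all add: c_def upd)
  ultimately have "poly_eval (insert b B) c x = q (x b) x" for x
    unfolding poly_eval_insert[OF insert.hyps] by (simp only: F3_interpolation[of "\<lambda>t. q t x"])
  then have "p x = poly_eval (insert b B) c x" for x by (simp add: q_def)
  then show ?case by blast
qed

text \<open>The coefficients of the difference in direction \<open>b\<close>: a linear factor
  \<open>t\<close> contributes 1, and a factor \<open>t^2\<close> contributes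
  \<open>2 * t + 1\<close>.\<close>

definition diff_coeff :: "'v \<Rightarrow> (('v \<Rightarrow> nat) \<Rightarrow> F3) \<Rightarrow> ('v \<Rightarrow> nat) \<Rightarrow> F3"
  where "diff_coeff b c e = (if e b = 0 then c (e(b := 1)) + c (e(b := 2)) else
    if e b = 1 then 2 * c (e(b := 2)) else 0)"

lemma poly_eval_add: "poly_eval B (\<lambda>e. c e + d e) x = poly_eval B c x + poly_eval B d x"
  by (simp add: poly_eval_def distrib_right sum.distrib)

lemma poly_eval_mult: "poly_eval B (\<lambda>e. a * c e) x = a * poly_eval B c x"
  by (simp add: poly_eval_def sum_distrib_left mult.assoc)

lemma poly_eval_0: "poly_eval B (\<lambda>e. 0) x = 0"
  by (simp add: poly_eval_def)

lemma poly_eval_diff_coeff: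
  assumes "finite B" "b \<in> B"
  shows "poly_eval B c (x(b := x b + 1)) - poly_eval B c x = poly_eval B (diff_coeff b c) x"
proof -
  obtain B' where B: "B = insert b B'" "b \<notin> B'" using assms(2) by (meson mk_disjoint_insert)
  then have fin: "finite B'" using assms(1) by simp
  have d: "(\<lambda>e. diff_coeff b c (e(b := 0))) = (\<lambda>e. c (e(b := 1)) + c (e(b := 2)))"
    "(\<lambda>e. diff_coeff b c (e(b := 1))) = (\<lambda>e. 2 * c (e(b := 2)))"
    "(\<lambda>e. diff_coeff b c (e(b := 2))) = (\<lambda>e. 0)"
    by (simp_all add: diff_coeff_def)
  show ?thesis
    unfolding B(1) poly_eval_insert[OF fin B(2)] d poly_eval_add poly_eval_mult poly_eval_0
    by (simp add: poly_eval_upd B(2) power2_eq_square algebra_simps)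
qed

lemma F3_scale_simps: "F3_scale 0 v = 0" "F3_scale 1 v = v" "F3_scale 2 v = v + v"
  by (simp_all add: F3_scale_def Rep_F3 numeral_2_eq_2)

text \<open>Iterated differences in basis directions detect the algebraic degree because the
  exponents, being at most 2, do not vanish modulo 3.\<close>

fun deg_lt :: "'v::ab_group_add set \<Rightarrow> nat \<Rightarrow> ('v \<Rightarrow> F3) \<Rightarrow> bool"
  where "deg_lt B 0 h \<longleftrightarrow> (\<forall>x. h x = 0)"
  | "deg_lt B (Suc d) h \<longleftrightarrow> (\<forall>b\<in>B. deg_lt B d (\<lambda>x. h (x + b) - h x))"

lemma deg_lt_add: "deg_lt B d g \<Longrightarrow> deg_lt B d h \<Longrightarrow> deg_lt B d (\<lambda>x. g x + h x)"
proof (induction d arbitrary: g h)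
  case (Suc d)
  have "deg_lt B d (\<lambda>x. (g (x + b) - g x) + (h (x + b) - h x))" if "b \<in> B" for b
    using Suc that by simp
  then show ?case by (simp add: add_diff_add)
qed simp

lemma deg_lt_Suc: "deg_lt B d h \<Longrightarrow> deg_lt B (Suc d) h"
proof (induction d arbitrary: h)
  case (Suc d)
  then show ?case by (metis deg_lt.simps(2))
qed simp

lemma deg_lt_const: "deg_lt B (Suc 0) (\<lambda>x. c)"
  by simp

lemma deg_lt_additive:
  assumes "\<And>x y. g (x + y) = g x + g y"
  shows "deg_lt B (Suc (Suc 0)) g"
  by (simp add: assms)

lemma deg_lt_biadditive:
  assumes "\<And>x x' y. g (x + x') y = g x y + g x' y" "\<And>x y y'. g x (y + y') = g x y + g x y'"
  shows "deg_lt B (Suc (Suc (Suc 0))) (\<lambda>x. g x x)"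
  unfolding deg_lt.simps(2)[of _ "Suc (Suc 0)"]
proof
  fix b
  have "(\<lambda>x. g (x + b) (x + b) - g x x) = (\<lambda>x. g x b + g b x + g b b)"
    by (rule ext) (simp only: assms diff_eq_eq add_ac)
  moreover have "deg_lt B (Suc (Suc 0)) \<dots>"
    by (intro deg_lt_add deg_lt_additive[of "\<lambda>x. g x b"] deg_lt_additive[of "\<lambda>x. g b x"]
        deg_lt_Suc[OF deg_lt_const] assms)
  ultimately show "deg_lt B (Suc (Suc 0)) (\<lambda>x. g (x + b) (x + b) - g x x)" by simp
qed

text \<open>One difference leaves three biadditive terms on the diagonal, three additive terms and a
  constant.\<close>

lemma deg_lt_triadditive:
  assumes "\<And>x x' y z. g (x + x') y z = g x y z + g x' y z" "\<And>x y y' z. g x (y + y') z = g x y z + g x y' z"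
    "\<And>x y z z'. g x y (z + z') = g x y z + g x y z'"
  shows "deg_lt B (Suc (Suc (Suc (Suc 0)))) (\<lambda>x. g x x x)"
  unfolding deg_lt.simps(2)[of _ "Suc (Suc (Suc 0))"]
proof
  fix b
  have "(\<lambda>x. g (x + b) (x + b) (x + b) - g x x x) =
      (\<lambda>x. g x x b + g x b x + g b x x + (g x b b + g b x b + g b b x) + g b b b)"
    by (rule ext) (simp only: assms diff_eq_eq add_ac)
  moreover have "deg_lt B (Suc (Suc (Suc 0))) \<dots>"
    by (intro deg_lt_add deg_lt_biadditive[of "\<lambda>x y. g x y b"] deg_lt_biadditive[of "\<lambda>x y. g x b y"]
        deg_lt_biadditive[of "\<lambda>x y. g b x y"] deg_lt_Suc[OF deg_lt_additive[of "\<lambda>x. g x b b"]]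
        deg_lt_Suc[OF deg_lt_additive[of "\<lambda>x. g b x b"]] deg_lt_Suc[OF deg_lt_additive[of "\<lambda>x. g b b x"]]
        deg_lt_Suc[OF deg_lt_Suc[OF deg_lt_const]] assms)
  ultimately show "deg_lt B (Suc (Suc (Suc 0))) (\<lambda>x. g (x + b) (x + b) (x + b) - g x x x)" by simp
qed

lemma sum_exponents_upd:
  fixes e :: "'v \<Rightarrow> nat"
  assumes "finite B" "b \<in> B"
  shows "(\<Sum>b'\<in>B. (e(b := i)) b') + e b = (\<Sum>b'\<in>B. e b') + i"
proof -
  have "(\<Sum>b'\<in>B - {b}. (e(b := i)) b') = (\<Sum>b'\<in>B - {b}. e b')" by (rule sum.cong) auto
  then show ?thesis using sum.remove[OF assms, of e] sum.remove[OF assms, of "e(b := i)"] by simp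
qed

lemma anf_exponents_upd:
  assumes "e \<in> anf_exponents B" "b \<in> B" "i \<le> 2"
  shows "e(b := i) \<in> anf_exponents B"
  using assms by (auto simp: anf_exponents_def PiE_def extensional_def Pi_def)

text \<open>A coefficient can be recovered from differences in a direction where its exponent is
  nonzero; exponents equal to 2 have to be treated first.\<close>

lemma diff_coeff_degree:
  assumes "finite B"
  shows "(\<forall>b\<in>B. \<forall>e\<in>anf_exponents B. d \<le> sum e B \<longrightarrow> diff_coeff b c e = 0) \<longleftrightarrow>
    (\<forall>e\<in>anf_exponents B. Suc d \<le> sum e B \<longrightarrow> c e = 0)" (is "?L \<longleftrightarrow> ?R")
proof
  assume L: ?L
  \<comment> \<open>The difference has coefficient \<open>2 * c e\<close> at
    \<open>e(b := 1)\<close>, and 2 is invertible.\<close>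
  have two: "c e = 0" if e: "e \<in> anf_exponents B" "Suc d \<le> sum e B" and b: "b \<in> B" "e b = 2" for e b
  proof -
    have "diff_coeff b c (e(b := 1)) = 0"
      using L b(1) anf_exponents_upd[OF e(1) b(1), of 1] sum_exponents_upd[OF assms b(1), of e 1] e(2) b(2) by auto
    moreover have "e(b := 1, b := 2) = e" using b(2) by auto
    ultimately show ?thesis by (simp add: diff_coeff_def)
  qed
  show ?R
  proof (intro ballI impI)
    fix e assume e: "e \<in> anf_exponents B" "Suc d \<le> sum e B"
    then obtain b where b: "b \<in> B" "e b \<noteq> 0"
      by (metis Suc_n_not_le_n le_trans sum.neutral zero_le)
    have "e b \<le> 2" using e(1) b(1) by (auto simp: anf_exponents_def)
    with b(2) consider "e b = 2" | "e b = 1" by linarith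
    then show "c e = 0"
    proof cases
      case 1
      then show ?thesis using two e b by blast
    next
      case 2
      \<comment> \<open>At \<open>e(b := 0)\<close> the difference has coefficient
        \<open>c e + c (e(b := 2))\<close>; the second summand is removed by
        \<open>two\<close>.\<close>
      have "c (e(b := 2)) = 0"
        by (rule two[OF _ _ b(1)])
           (use anf_exponents_upd[OF e(1) b(1), of 2] sum_exponents_upd[OF assms b(1), of e 2] e(2) 2 in auto)
      moreover have "diff_coeff b c (e(b := 0)) = 0"
        using L b(1) anf_exponents_upd[OF e(1) b(1), of 0] sum_exponents_upd[OF assms b(1), of e 0] e(2) 2 by auto
      moreover have "e(b := 0, b := 1) = e" using 2 by auto
      ultimately show ?thesis by (simp add: diff_coeff_def)
    qed
  qed
next
  assume R: ?R
  show ?L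
  proof (intro ballI impI)
    fix b e assume b: "b \<in> B" and e: "e \<in> anf_exponents B" "d \<le> sum e B"
    have "c (e(b := i)) = 0" if "e b < i" "i \<le> 2" for i
      using R anf_exponents_upd[OF e(1) b that(2)] sum_exponents_upd[OF assms b, of e i] e(2) that by auto
    then show "diff_coeff b c e = 0" by (auto simp: diff_coeff_def)
  qed
qed

section \<open>Normal forms relative to a fixed basis\<close>

context
  fixes B :: "'v::{ab_group_add,finite} set"
  assumes exponent_3: "\<And>v::'v. v + v + v = 0" and basis: "F3_basis B"
begin

interpretation V: vector_space "F3_scale :: F3 \<Rightarrow> 'v \<Rightarrow> 'v"
  by (rule vector_space_F3_scale[OF exponent_3])

lemma basis_independent: "V.independent B" and basis_span: "V.span B = UNIV"
  using basis by (auto simp: F3_basis_def)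

lemma coordinates_exist: "\<exists>v. \<forall>b\<in>B. V.representation B v b = x b"
proof -
  define v where "v = (\<Sum>b\<in>B. F3_scale (x b) b)"
  have "V.representation B v = (\<lambda>b. if b \<in> B then x b else 0)"
  proof (rule V.representation_eqI[OF basis_independent])
    have "(\<Sum>b\<in>{b. (if b \<in> B then x b else 0) \<noteq> 0}. F3_scale (if b \<in> B then x b else 0) b) =
        (\<Sum>b\<in>B. F3_scale (if b \<in> B then x b else 0) b)"
      by (rule sum.mono_neutral_left) (auto simp: F3_scale_simps)
    also have "\<dots> = v" unfolding v_def by (rule sum.cong) auto
    finally show "(\<Sum>b\<in>{b. (if b \<in> B then x b else 0) \<noteq> 0}. F3_scale (if b \<in> B then x b else 0) b) = v" .
  qed (auto simp: basis_span split: if_splits)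
  then show ?thesis by (intro exI[of _ v]) simp
qed

lemma is_anf_iff: "is_anf B h c \<longleftrightarrow> (\<forall>v. h v = poly_eval B c (V.representation B v))"
  by (simp add: is_anf_def poly_eval_def monomial_def)

lemma representation_add_basis:
  assumes "b \<in> B"
  shows "V.representation B (v + b) = (V.representation B v)(b := V.representation B v b + 1)"
  using assms by (auto simp: V.representation_add basis_independent basis_span V.representation_basis)

lemma poly_eval_cong: "(\<And>b. b \<in> B \<Longrightarrow> x b = y b) \<Longrightarrow> poly_eval B c x = poly_eval B c y"
  by (simp add: poly_eval_def monomial_def)

lemma anf_zero:
  assumes "is_anf B h c" "\<And>v. h v = 0" "e \<in> anf_exponents B"
  shows "c e = 0"
proof (rule poly_eval_eq_0_imp[OF _ _ assms(3)])
  fix x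
  obtain v where "\<forall>b\<in>B. V.representation B v b = x b" using coordinates_exist by blast
  then have "poly_eval B c x = poly_eval B c (V.representation B v)" by (intro poly_eval_cong) simp
  then show "poly_eval B c x = 0" using assms(1,2) is_anf_iff by metis
qed simp

lemma is_anf_diff:
  assumes "is_anf B h c" "b \<in> B"
  shows "is_anf B (\<lambda>x. h (x + b) - h x) (diff_coeff b c)"
  using assms by (simp add: is_anf_iff representation_add_basis poly_eval_diff_coeff)

lemma anf_exists: "\<exists>c. is_anf B h c"
proof -
  define p where "p x = h (\<Sum>b\<in>B. F3_scale (x b) b)" for x
  have "\<exists>c. \<forall>x. p x = poly_eval B c x"
    by (rule poly_eval_exists) (auto simp: p_def intro!: arg_cong[of _ _ h] sum.cong)
  moreover have "p (V.representation B v) = h v" for v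
    unfolding p_def by (rule arg_cong[of _ _ h], rule V.sum_representation_eq)
       (auto simp: basis_independent basis_span)
  ultimately show ?thesis unfolding is_anf_iff by metis
qed

text \<open>Each difference passes to \<open>diff_coeff\<close>, and
  \<open>diff_coeff_degree\<close> lowers the bound by one.\<close>

lemma deg_lt_iff_anf:
  assumes "is_anf B h c"
  shows "deg_lt B d h \<longleftrightarrow> (\<forall>e\<in>anf_exponents B. d \<le> sum e B \<longrightarrow> c e = 0)"
  using assms
proof (induction d arbitrary: h c)
  case 0
  show ?case
  proof
    show "\<forall>e\<in>anf_exponents B. 0 \<le> sum e B \<longrightarrow> c e = 0" if "deg_lt B 0 h"
      using anf_zero[OF 0] that by simp
    show "deg_lt B 0 h" if "\<forall>e\<in>anf_exponents B. 0 \<le> sum e B \<longrightarrow> c e = 0"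
      using 0 that by (simp add: is_anf_iff poly_eval_def)
  qed
next
  case (Suc d)
  have "deg_lt B (Suc d) h \<longleftrightarrow> (\<forall>b\<in>B. \<forall>e\<in>anf_exponents B. d \<le> sum e B \<longrightarrow> diff_coeff b c e = 0)"
    using Suc.IH[OF is_anf_diff[OF Suc.prems]] by simp
  then show ?case using diff_coeff_degree[of B d c] by simp
qed

lemma anf_degree_eqI:
  assumes "is_anf B h c" "deg_lt B (Suc d) h" "\<not> deg_lt B d h"
  shows "anf_degree B c = d"
proof -
  define D where "D = {(\<Sum>b\<in>B. e b) |e. e \<in> anf_exponents B \<and> c e \<noteq> 0}"
  have upper: "x \<le> d" if x: "x \<in> D" for x
  proof -
    obtain e where "x = (\<Sum>b\<in>B. e b)" "e \<in> anf_exponents B" "c e \<noteq> 0"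
      using x unfolding D_def by blast
    moreover then have "\<not> Suc d \<le> sum e B"
      using assms(2) unfolding deg_lt_iff_anf[OF assms(1)] by blast
    ultimately show ?thesis by linarith
  qed
  obtain e where e: "e \<in> anf_exponents B" "d \<le> sum e B" "c e \<noteq> 0"
    using assms(3) unfolding deg_lt_iff_anf[OF assms(1)] by blast
  then have mem: "sum e B \<in> D" unfolding D_def by blast
  with e(2) upper[OF mem] have "d \<in> D" by simp
  moreover have "finite D"
    by (rule finite_subset[OF _ finite_atMost[of d]]) (use upper in blast)
  ultimately show ?thesis
    unfolding anf_degree_def D_def[symmetric]
    by (intro Max_eqI) (use upper in \<open>simp_all, blast\<close>)
qed

text \<open>The periods of \<open>g\<close> form a subspace, and it contains
  \<open>B\<close>.\<close>

lemma periodic_if_basis_periodic: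
  assumes "\<And>b x. b \<in> B \<Longrightarrow> g (x + b) = g x"
  shows "g (x + a) = g x"
proof -
  let ?P = "{a. \<forall>x. g (x + a) = g x}"
  have "V.subspace ?P"
  proof (rule V.subspaceI)
    show add: "a + a' \<in> ?P" if "a \<in> ?P" "a' \<in> ?P" for a a'
      using that by (auto simp: add.assoc[symmetric])
    show "F3_scale c a \<in> ?P" if "a \<in> ?P" for c a
      using that add[OF that that] by (cases c rule: F3_cases) (simp_all add: F3_scale_simps)
  qed simp
  moreover have "B \<subseteq> ?P" using assms by auto
  ultimately have "V.span B \<subseteq> ?P" by (rule V.span_minimal[rotated])
  then show ?thesis unfolding basis_span by blast
qed

text \<open>Differences in different directions commute, so the induction reduces to periodicity.
  This passes from basis directions to arbitrary ones, as the witness for the lower degree bound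
  requires.\<close>

lemma deg_lt_difference: "deg_lt B (Suc d) h \<Longrightarrow> deg_lt B d (\<lambda>x. h (x + a) - h x)"
proof (induction d arbitrary: h)
  case 0
  then show ?case using periodic_if_basis_periodic[of h] by simp
next
  case (Suc d)
  show ?case
    unfolding deg_lt.simps(2)
  proof
    fix b assume "b \<in> B"
    then have "deg_lt B (Suc d) (\<lambda>x. h (x + b) - h x)" using Suc.prems by simp
    note IH = Suc.IH[OF this]
    have eq: "(\<lambda>x. h (x + a + b) - h (x + a) - (h (x + b) - h x)) =
        (\<lambda>x. h (x + b + a) - h (x + b) - (h (x + a) - h x))"
      by (rule ext) (simp add: algebra_simps)
    show "deg_lt B d (\<lambda>x. h (x + b + a) - h (x + b) - (h (x + a) - h x))"
      using IH unfolding eq .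
  qed
qed

end

lemma has_algebraic_degreeI:
  fixes h :: "'v::{ab_group_add,finite} \<Rightarrow> F3"
  assumes exponent_3: "\<And>v::'v. v + v + v = 0"
    and "\<And>B. F3_basis B \<Longrightarrow> deg_lt B (Suc d) h" "\<And>B. F3_basis B \<Longrightarrow> \<not> deg_lt B d h"
  shows "has_algebraic_degree h d"
proof -
  interpret V: vector_space "F3_scale :: F3 \<Rightarrow> 'v \<Rightarrow> 'v"
    by (rule vector_space_F3_scale[OF exponent_3])
  obtain B where "B \<subseteq> UNIV" "V.independent B" "UNIV \<subseteq> V.span B" "card B = V.dim UNIV"
    by (rule V.basis_exists[of UNIV])
  then have "F3_basis B" by (auto simp: F3_basis_def)
  then have "\<exists>B c. F3_basis B \<and> is_anf B h c"
    using anf_exists[OF exponent_3] by blast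
  moreover have "anf_degree B c = d" if "F3_basis B" "is_anf B h c" for B c
    by (rule anf_degree_eqI[OF exponent_3 that assms(2,3)[OF that(1)]])
  ultimately show ?thesis unfolding has_algebraic_degree_def by blast
qed

section \<open>The algebraic degree of \<open>f\<close>\<close>

context quartic_setting
begin

lemma cubic_f: "cubic f"
  unfolding cubic_def
proof (rule has_algebraic_degreeI[OF triple])
  fix B :: "'a set"
  assume B: "F3_basis B"
  \<comment> \<open>On the diagonal this triadditive map is the cubic part of
    \<open>f\<close>.\<close>
  define g where "g x y z = tr (x * y * \<sigma> z) - tr (x * \<sigma> y * \<sigma> z)" for x y z
  have "deg_lt B (Suc (Suc (Suc (Suc 0)))) (\<lambda>x. g x x x)"
    by (rule deg_lt_triadditive[of g])
       (simp_all only: g_def tr_add \<sigma>_add distrib_left distrib_right add_diff_add)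
  moreover have "deg_lt B (Suc (Suc (Suc (Suc 0)))) (\<lambda>x. tr (\<alpha> * x * \<rho> x))"
    by (rule deg_lt_Suc, rule deg_lt_biadditive[of "\<lambda>x y. tr (\<alpha> * x * \<rho> y)"])
       (simp_all only: tr_add \<rho>_add distrib_left distrib_right)
  ultimately have "deg_lt B (Suc (Suc (Suc (Suc 0)))) (\<lambda>x. g x x x + tr (\<alpha> * x * \<rho> x))"
    by (rule deg_lt_add)
  also have "(\<lambda>x. g x x x + tr (\<alpha> * x * \<rho> x)) = f"
    by (rule ext) (simp only: f_def g_def tr_add tr_simps)
  finally show "deg_lt B (Suc 3) f" by (simp only: eval_nat_numeral BitM.simps One_nat_def)
  show "\<not> deg_lt B 3 f"
  proof
    assume "deg_lt B 3 f"
    then have *: "deg_lt B (Suc (Suc (Suc 0))) f" by (simp only: numeral_3_eq_3)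
    obtain a b c where nz: "f (a + b + c) - f (a + b) - f (a + c) - f (b + c) + f a + f b + f c - f 0 \<noteq> 0"
      using third_difference_f by blast
    \<comment> \<open>Degree below 3 would annihilate the third difference in the directions
      \<open>c\<close>, \<open>b\<close>, \<open>a\<close>; it is evaluated at 0.\<close>
    note deg_lt_difference[OF triple B deg_lt_difference[OF triple B deg_lt_difference[OF triple B *, of c], of b], of a]
    then have "f (0 + a + b + c) - f (0 + a + b) - (f (0 + a + c) - f (0 + a)) -
        (f (0 + b + c) - f (0 + b) - (f (0 + c) - f 0)) = 0"
      unfolding deg_lt.simps(1) by blast
    moreover have "f (0 + a + b + c) - f (0 + a + b) - (f (0 + a + c) - f (0 + a)) -
        (f (0 + b + c) - f (0 + b) - (f (0 + c) - f 0)) =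
        f (a + b + c) - f (a + b) - f (a + c) - f (b + c) + f a + f b + f c - f 0"
      by (simp add: algebra_simps)
    ultimately show False using nz by metis
  qed
qed

end

section \<open>Additive maps and subgroups of exponent three\<close>

lemma F3_linear_if_additive:
  fixes L :: "'v::ab_group_add \<Rightarrow> 'w::ab_group_add"
  assumes "\<And>v::'v. v + v + v = 0" "\<And>w::'w. w + w + w = 0" and add: "\<And>x y. L (x + y) = L x + L y"
  shows "F3_linear L"
proof -
  have 0: "L 0 = 0" using add[of 0 0] by simp
  have "L (F3_scale c x) = F3_scale c (L x)" for c x
    by (cases c rule: F3_cases) (simp_all add: F3_scale_simps 0 add)
  then show ?thesis
    unfolding Vector_Spaces.linear_iff by (intro conjI allI vector_space_F3_scale assms)
qed

lemma additive_functional: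
  fixes g :: "F3 ^ 'm \<Rightarrow> F3"
  assumes add: "\<And>x y. g (x + y) = g x + g y"
  shows "g x = (\<Sum>i\<in>UNIV. x $ i * g (axis i 1))"
proof -
  have 0: "g 0 = 0" using add[of 0 0] by (simp only: add_0_right add_cancel_right_right)
  have scale: "g (c *s v) = c * g v" for c v
    unfolding F3_scale_vec[symmetric]
    by (cases c rule: F3_cases) (simp_all only: F3_scale_simps 0 add mult_2 mult_zero_left mult_1)
  have sum: "g (\<Sum>i\<in>I. h i) = (\<Sum>i\<in>I. g (h i))" for I :: "'m set" and h
    by (induction I rule: infinite_finite_induct) (simp_all add: 0 add)
  have "g x = g (\<Sum>i\<in>UNIV. (x $ i) *s axis i 1)" by (simp only: basis_expansion)
  then show ?thesis by (simp only: sum scale)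
qed

text \<open>A subgroup of exponent three is a subspace. Counting combinations of a basis gives
  \<open>3 ^ card B\<close> elements, so the basis can be indexed by \<open>'m\<close>.\<close>

lemma subgroup_coordinates:
  fixes H :: "'v::{ab_group_add,finite} set"
  assumes exponent_3: "\<And>v::'v. v + v + v = 0" and H: "add_subgroup H"
    and card: "card H = 3 ^ CARD('m::finite)"
  obtains L :: "F3 ^ 'm \<Rightarrow> 'v" where "\<And>x y. L (x + y) = L x + L y" "bij_betw L UNIV H"
proof -
  interpret V: vector_space "F3_scale :: F3 \<Rightarrow> 'v \<Rightarrow> 'v"
    by (rule vector_space_F3_scale[OF exponent_3])
  have subspace: "V.subspace H"
  proof (rule V.subspaceI)
    show "F3_scale c x \<in> H" if "x \<in> H" for c x
      using add_subgroupD(1)[OF H] add_subgroupD(4)[OF H that that] that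
      by (cases c rule: F3_cases) (simp_all add: F3_scale_simps)
  qed (rule add_subgroupD[OF H]; assumption?)+
  obtain B where B: "B \<subseteq> H" "V.independent B" "H \<subseteq> V.span B" "card B = V.dim H"
    by (rule V.basis_exists[of H])
  have span: "V.span B = H"
    using V.span_minimal[OF B(1) subspace] B(3) by blast
  define comb where "comb u = (\<Sum>b\<in>B. F3_scale (u b) b)" for u
  have comb_add: "comb (\<lambda>b. u b + u' b) = comb u + comb u'" for u u'
    by (simp add: comb_def V.scale_left_distrib sum.distrib)
  have comb_diff: "comb (\<lambda>b. u b - u' b) = comb u - comb u'" for u u'
    by (simp add: comb_def V.scale_left_diff_distrib sum_subtractf)
  have eq: "u b = u' b" if "comb u = comb u'" "b \<in> B" for u u' b
  proof (rule ccontr)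
    assume "u b \<noteq> u' b"
    then have "\<exists>v\<in>B. u v - u' v \<noteq> 0" using that(2) by auto
    moreover have "(\<Sum>v\<in>B. F3_scale (u v - u' v) v) = 0"
      using comb_diff[of u u'] that(1) by (simp add: comb_def)
    ultimately have "V.dependent B"
      unfolding V.dependent_finite[OF finite] by (intro exI[of _ "\<lambda>v. u v - u' v"] conjI)
    with B(2) show False by blast
  qed
  have "H = comb ` (B \<rightarrow>\<^sub>E UNIV)"
  proof
    show "comb ` (B \<rightarrow>\<^sub>E UNIV) \<subseteq> H"
      unfolding span[symmetric] V.span_finite[OF finite] comb_def by auto
    show "H \<subseteq> comb ` (B \<rightarrow>\<^sub>E UNIV)"
    proof
      fix x assume "x \<in> H"
      then obtain u where "x = comb u"
        unfolding span[symmetric] V.span_finite[OF finite] comb_def by auto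
      moreover have "comb u = comb (restrict u B)" by (simp add: comb_def)
      ultimately show "x \<in> comb ` (B \<rightarrow>\<^sub>E UNIV)" by auto
    qed
  qed
  moreover have "inj_on comb (B \<rightarrow>\<^sub>E UNIV)"
  proof (rule inj_onI)
    fix u u' :: "'v \<Rightarrow> F3"
    assume "u \<in> B \<rightarrow>\<^sub>E UNIV" "u' \<in> B \<rightarrow>\<^sub>E UNIV" "comb u = comb u'"
    then show "u = u'" using eq[of u u'] by (intro PiE_ext[of u B _ u']) blast+
  qed
  ultimately have "card H = 3 ^ card B"
    by (simp add: card_image card_PiE)
  then have "card B = CARD('m)" using card by simp
  then obtain \<gamma> where \<gamma>: "bij_betw \<gamma> B (UNIV :: 'm set)"
    by (metis finite finite_same_card_bij)
  define L where "L x = comb (\<lambda>b. x $ \<gamma> b)" for x :: "F3 ^ 'm"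
  have add: "L (x + y) = L x + L y" for x y
    by (simp add: L_def comb_add)
  have "inj L"
  proof (rule injI)
    fix x y assume "L x = L y"
    then have *: "x $ \<gamma> b = y $ \<gamma> b" if "b \<in> B" for b using eq[of _ _ b] that by (simp add: L_def)
    show "x = y"
      unfolding vec_eq_iff
    proof
      fix i
      obtain b where "b \<in> B" "i = \<gamma> b" using \<gamma> unfolding bij_betw_def by blast
      then show "x $ i = y $ i" using * by simp
    qed
  qed
  moreover have "range L \<subseteq> H"
    unfolding span[symmetric] V.span_finite[OF finite] L_def comb_def by auto
  moreover have "card (range L) = card H"
    using \<open>inj L\<close> by (simp add: card_image card)
  ultimately have "bij_betw L UNIV H" by (simp add: bij_betw_def card_subset_eq)
  with add that show thesis by blast
qed

section \<open>EA-equivalence\<close>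

context quartic_setting
begin

lemma EA_equivalent_f:
  assumes "card E = 3 ^ CARD('q::finite)" "card W = 3 ^ CARD('p::finite)"
  shows "\<exists>g :: F3 ^ 'q \<Rightarrow> F3 ^ 'p \<Rightarrow> F3. (\<forall>c. bent dot (g c)) \<and>
    EA_equivalent f (\<lambda>(x :: F3 ^ 'p, y1 :: F3 ^ 'q, y2 :: F3 ^ 'q). g y2 x + dot y1 y2)"
proof -
  obtain P :: "F3 ^ 'q \<Rightarrow> 'a" where P: "\<And>x y. P (x + y) = P x + P y" and bij_P: "bij_betw P UNIV E"
    using subgroup_coordinates[OF triple add_subgroups(1) assms(1)] by blast
  obtain T :: "F3 ^ 'p \<Rightarrow> 'a" where T: "\<And>x y. T (x + y) = T x + T y" and bij_T: "bij_betw T UNIV W"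
    using subgroup_coordinates[OF triple add_subgroups(3) assms(2)] by blast
  have P_mem: "P y \<in> E" and T_mem: "T x \<in> W" for x y
    using bij_P bij_T by (auto simp: bij_betw_def)
  \<comment> \<open>The vector that represents the functional \<open>tr (P y * M s)\<close> of
    \<open>y\<close>. Its inverse \<open>R\<close> parametrizes \<open>A\<close> so that the pairing
    of \<open>E\<close> with \<open>A\<close> becomes exactly \<open>dot\<close>.\<close>
  define Q :: "'a \<Rightarrow> F3 ^ 'q" where "Q s = (\<chi> i. tr (P (axis i 1) * M s))" for s
  have Q_add: "Q (s + s') = Q s + Q s'" for s s'
    by (simp add: Q_def vec_eq_iff M_add distrib_left tr_add)
  have dot_Q: "tr (P y * M s) = dot y (Q s)" for y s
    using additive_functional[of "\<lambda>y. tr (P y * M s)" y] by (simp add: P distrib_right tr_add dot_def Q_def)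
  have "inj_on Q A"
  proof (rule inj_onI)
    fix s s' assume s: "s \<in> A" "s' \<in> A" "Q s = Q s'"
    then have mem: "s - s' \<in> A" using add_subgroupD(2)[OF add_subgroups(2)] by blast
    have "Q (s - s') + Q s' = Q s" by (simp flip: Q_add)
    then have Q0: "Q (s - s') = 0" using s(3) by simp
    have "tr (e * M (s - s')) = 0" if "e \<in> E" for e
    proof -
      have "e \<in> range P" using \<open>e \<in> E\<close> bij_P by (simp add: bij_betw_def)
      then obtain y where "e = P y" by blast
      then show ?thesis by (simp add: dot_Q Q0 dot_def)
    qed
    then have "M (s - s') = 0" using tr_nondegenerate_on(1) M_mem[OF mem] by blast
    then have "s - s' = 0" by (rule M_eq_0[OF mem])
    then show "s = s'" by simp
  qed
  moreover have "card A = CARD(F3 ^ 'q)" using card_A_eq_card_E assms(1) by simp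
  ultimately have bij_Q: "bij_betw Q A UNIV"
    by (simp add: bij_betw_def card_image card_subset_eq del: CARD_vec)
  define R where "R = inv_into A Q"
  have R_mem: "R y \<in> A" and Q_R: "Q (R y) = y" for y
    using bij_Q by (auto simp: R_def bij_betw_def inv_into_into f_inv_into_f)
  have R: "R (x + y) = R x + R y" for x y
    using bij_Q R_mem Q_R Q_add by (metis (no_types, lifting) add_mem(2) bij_betw_def inj_onD)
  define g where "g c x = G (R c) (T x)" for c x
  have "bent dot (g c)" for c
  proof (rule bent_if_derivatives_balanced)
    show "dot (x + a) y = dot x y + dot a y" for x a y :: "F3 ^ 'p"
      by (simp add: dot_def distrib_right sum.distrib)
    fix a :: "F3 ^ 'p" assume "a \<noteq> 0"
    have "T 0 = 0" using T[of 0 0] by (simp only: add_0_right add_cancel_right_right)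
    then have "T a \<noteq> 0" using \<open>a \<noteq> 0\<close> bij_T by (metis UNIV_I bij_betw_def inj_onD)
    then have "N (R c) (T a) \<noteq> 0" using N_eq_0[OF R_mem T_mem] by blast
    then obtain w where "w \<in> W" "tr (w * N (R c) (T a)) \<noteq> 0"
      using tr_nondegenerate_on(3) N_mem[OF R_mem T_mem] by blast
    then obtain x where x: "tr (T x * N (R c) (T a)) \<noteq> 0"
      using bij_T by (metis bij_betw_imp_surj_on imageE)
    have "g c (x + a) - g c x = G (R c) (T a) + tr (T x * N (R c) (T a))" for x
      by (simp add: g_def T G_add[OF R_mem T_mem T_mem])
    then have "(\<Sum>x\<in>UNIV. omega_pow (g c (x + a) - g c x)) =
        (\<Sum>x\<in>UNIV. omega_pow (G (R c) (T a) + tr (T x * N (R c) (T a))))" by simp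
    also have "\<dots> = 0"
      by (rule sum_character_eq_0[OF add_subgroup_UNIV, where h = x])
         (use x in \<open>simp_all add: T distrib_right tr_add\<close>)
    finally show "(\<Sum>x\<in>UNIV. omega_pow (g c (x + a) - g c x)) = 0" .
  qed
  moreover have "EA_equivalent f (\<lambda>(x, y1, y2). g y2 x + dot y1 y2)"
  proof -
    \<comment> \<open>Coordinates adapted to the splitting; the equivalence then has factor 1 and
      zero affine summand.\<close>
    define L where "L = (\<lambda>(x, y1, y2). P y1 + R y2 + T x)"
    have exp_prod: "v + v + v = 0" for v :: "(F3 ^ 'p) \<times> (F3 ^ 'q) \<times> (F3 ^ 'q)"
      by (simp add: prod_eq_iff vec_eq_iff F3_triple)
    have "F3_linear L"
    proof (rule F3_linear_if_additive)
      show "v + v + v = 0" for v :: "(F3 ^ 'p) \<times> (F3 ^ 'q) \<times> (F3 ^ 'q)" by (rule exp_prod)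
      show "u + u + u = 0" for u :: 'a by (rule triple)
      show "L (z + z') = L z + L z'" for z z'
        by (simp add: L_def case_prod_beta P R T)
    qed
    then have "F3_affine L" unfolding F3_affine_def by (intro exI[of _ L] exI[of _ 0]) simp
    moreover have "F3_affine (\<lambda>w :: (F3 ^ 'p) \<times> (F3 ^ 'q) \<times> (F3 ^ 'q). 0 :: F3)"
      unfolding F3_affine_def
      by (intro exI[of _ "\<lambda>_. 0"] exI[of _ 0] conjI F3_linear_if_additive) (simp_all add: exp_prod F3_triple)
    moreover have "bij L"
    proof (rule bij_betw_imageI)
      show "inj L"
      proof (rule injI)
        fix z z' assume eq: "L z = L z'"
        obtain x y1 y2 x' y1' y2' where z: "z = (x, y1, y2)" "z' = (x', y1', y2')"
          by (metis prod_cases3)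
        have *: "P y1 + R y2 + T x = P y1' + R y2' + T x'" using eq by (simp add: L_def z)
        have "P y1 = P y1'" using arg_cong[OF *, of prE] by (simp only: pr_of_sum[OF P_mem R_mem T_mem])
        moreover have "R y2 = R y2'" using arg_cong[OF *, of prA] by (simp only: pr_of_sum[OF P_mem R_mem T_mem])
        moreover have "T x = T x'" using arg_cong[OF *, of prW] by (simp only: pr_of_sum[OF P_mem R_mem T_mem])
        ultimately show "z = z'"
          using bij_P bij_T Q_R unfolding z bij_betw_def by (metis UNIV_I inj_onD)
      qed
      show "range L = UNIV"
      proof (intro set_eqI iffI UNIV_I)
        fix u :: 'a
        obtain e s w where u: "e \<in> E" "s \<in> A" "w \<in> W" "u = e + s + w" using decompose[of u] by blast
        have "e \<in> range P" "w \<in> range T" using u bij_P bij_T by (simp_all add: bij_betw_def)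
        then obtain y1 x where "e = P y1" "w = T x" by blast
        moreover have "s = R (Q s)" using bij_Q u(2) unfolding R_def by (simp add: bij_betw_def)
        ultimately have "u = L (x, y1, Q s)" using u(4) by (simp add: L_def)
        then show "u \<in> range L" by blast
      qed
    qed
    moreover have "(\<lambda>(x, y1, y2). g y2 x + dot y1 y2) = (\<lambda>w. 1 * f (L w) + 0)"
    proof
      fix z :: "(F3 ^ 'p) \<times> (F3 ^ 'q) \<times> (F3 ^ 'q)"
      obtain x y1 y2 where z: "z = (x, y1, y2)" by (metis prod_cases3)
      have "f (L z) = g y2 x + dot y1 y2"
        unfolding z L_def prod.case f_decomposed[OF P_mem R_mem T_mem] dot_Q Q_R g_def ..
      then show "(case z of (x, y1, y2) \<Rightarrow> g y2 x + dot y1 y2) = 1 * f (L z) + 0"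
        unfolding z by simp
    qed
    moreover have "(1::F3) \<noteq> 0" by simp
    ultimately show ?thesis unfolding EA_equivalent_def by blast
  qed
  ultimately show ?thesis by blast
qed

end

section \<open>Finite fields of characteristic three\<close>

text \<open>Multiplication by a nonzero \<open>x\<close> permutes the nonzero elements, so their
  product is multiplied by 1.\<close>

lemma finite_field_power_card:
  fixes x :: "'a::{field,finite}"
  shows "x ^ CARD('a) = x"
proof (cases "x = 0")
  case False
  let ?U = "UNIV - {0::'a}"
  have "(\<Prod>y\<in>?U. x * y) = \<Prod>?U"
    by (rule prod.reindex_bij_witness[of _ "\<lambda>y. y / x" "\<lambda>y. x * y"]) (use False in auto)
  moreover have "(\<Prod>y\<in>?U. x * y) = x ^ (CARD('a) - 1) * \<Prod>?U"
    by (simp add: prod.distrib card_Diff_singleton)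
  moreover have "\<Prod>?U \<noteq> 0" by simp
  ultimately have "x ^ (CARD('a) - 1) = 1" by simp
  then have "x ^ Suc (CARD('a) - 1) = x" by (simp only: power_Suc mult_1_right)
  moreover have "Suc (CARD('a) - 1) = CARD('a)" by simp
  ultimately show ?thesis by (simp only:)
qed simp

text \<open>The sum of all elements is unchanged by adding 1 to each of them, so the number of
  elements is zero in the field.\<close>

lemma char_3_if_card_power_3:
  assumes "CARD('a::{field,finite}) = 3 ^ n"
  shows "(3::'a) = 0"
proof -
  have "(\<Sum>y\<in>UNIV. y) = (\<Sum>y\<in>UNIV. y + (1::'a))"
    by (rule sum_translate_UNIV[symmetric])
  then have "of_nat CARD('a) = (0::'a)" by (simp add: sum.distrib)
  then show ?thesis using assms by (simp add: zero_power)
qed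

lemma frobenius_add:
  assumes "(3::'a::field) = 0"
  shows "(x + y) ^ (3 ^ i) = x ^ (3 ^ i) + (y::'a) ^ (3 ^ i)"
proof (induction i)
  case (Suc i)
  have *: "(x + y) ^ 3 = x ^ 3 + y ^ 3" for x y :: 'a
  proof -
    have "(x + y) ^ 3 = x ^ 3 + 3 * (x * x * y + x * y * y) + y ^ 3"
      by (simp add: power3_eq_cube algebra_simps)
    then show ?thesis unfolding assms by (simp only: mult_zero_left add_0_right)
  qed
  show ?case by (simp only: power_Suc2 power_mult Suc *)
qed simp

lemma iterate_frobenius:
  assumes "\<And>x::'a::monoid_mult. x ^ (3 ^ n) = x"
  shows "x ^ (3 ^ (n * i)) = (x::'a)"
proof (induction i)
  case (Suc i)
  have "x ^ (3 ^ (n * Suc i)) = (x ^ (3 ^ n)) ^ (3 ^ (n * i))"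
    by (simp only: mult_Suc_right power_add power_mult[symmetric])
  then show ?case by (simp only: assms Suc)
qed simp

section \<open>The prime field and the trace\<close>

lemma of_F3_simps: "of_F3 0 = 0" "of_F3 1 = 1" "of_F3 2 = 2"
  by (simp_all add: of_F3_def Rep_F3)

lemma of_F3_add:
  assumes "(3::'a::field) = 0"
  shows "of_F3 (a + b) = of_F3 a + (of_F3 b :: 'a)"
proof -
  have "1 + 1 = (2::F3)" "1 + 2 = (0::F3)" "2 + 1 = (0::F3)" "2 + 2 = (1::F3)"
    by (simp_all add: F3_numerals)
  moreover have "1 + 1 = (2::'a)" "1 + 2 = (3::'a)" "2 + 1 = (3::'a)" "2 + 2 = 3 + (1::'a)"
    by simp_all
  ultimately show ?thesis
    by (cases a rule: F3_cases; cases b rule: F3_cases)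
       (simp_all only: of_F3_simps add_0_left add_0_right assms)
qed

lemma two_nonzero_char_3:
  assumes "(3::'a::field) = 0"
  shows "(2::'a) \<noteq> 0"
proof
  assume two: "(2::'a) = 0"
  have "(1::'a) = 3 - 2" by simp
  then show False unfolding assms two by simp
qed

lemma two_eq_minus_1:
  assumes "(3::'a::field) = 0"
  shows "(2::'a) = - 1"
proof -
  have "(2::'a) = 3 - 1" by simp
  then show ?thesis unfolding assms by simp
qed

lemma of_F3_inject:
  assumes "(3::'a::field) = 0" "of_F3 a = (of_F3 b :: 'a)"
  shows "a = b"
proof -
  have "(2::'a) - 1 = 1" by simp
  then have "(2::'a) \<noteq> 1" by (metis diff_self zero_neq_one)
  then have "(0::'a) \<noteq> 1" "(1::'a) \<noteq> 0" "(2::'a) \<noteq> 1" "(1::'a) \<noteq> 2" "(2::'a) \<noteq> 0" "(0::'a) \<noteq> 2"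
    using two_nonzero_char_3[OF assms(1)] by (auto dest: sym)
  then show ?thesis using assms(2)
    by (cases a rule: F3_cases; cases b rule: F3_cases) (simp_all only: of_F3_simps)
qed

text \<open>Cubing shifts the summands cyclically, so the sum is a root of \<open>s^3 - s\<close>
  and lies in the prime field. This justifies the definite description in \<open>Tr\<close>.\<close>

lemma of_F3_Tr:
  fixes x :: "'a::{field,finite}"
  assumes card: "CARD('a) = 3 ^ n"
  shows "of_F3 (Tr n x) = (\<Sum>i<n. x ^ (3 ^ i))"
proof -
  note char3 = char_3_if_card_power_3[OF card]
  define s where "s = (\<Sum>i<n. x ^ (3 ^ i))"
  have frob: "(a + b) ^ 3 = a ^ 3 + b ^ 3" for a b :: 'a
    using frobenius_add[OF char3, of a b 1] by (simp only: power_one_right)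
  have "(\<Sum>i\<in>I. h i) ^ 3 = (\<Sum>i\<in>I. h i ^ 3)" for I :: "nat set" and h :: "nat \<Rightarrow> 'a"
    by (induction I rule: infinite_finite_induct) (simp_all add: frob)
  then have "s ^ 3 = (\<Sum>i<n. x ^ (3 ^ Suc i))"
    unfolding s_def by (simp only: power_Suc2 power_mult)
  also have "\<dots> + x ^ (3 ^ 0) = s + x ^ (3 ^ n)"
    unfolding s_def using sum.lessThan_Suc_shift[of "\<lambda>i. x ^ (3 ^ i)" n] by (simp add: add.commute)
  then have "(\<Sum>i<n. x ^ (3 ^ Suc i)) = s"
    using finite_field_power_card[of x] card by simp
  finally have "s * (s - 1) * (s + 1) = 0"
    by (simp add: algebra_simps power3_eq_cube)
  then have "s = 0 \<or> s = 1 \<or> s = 2"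
    unfolding two_eq_minus_1[OF char3] by (simp add: eq_neg_iff_add_eq_0)
  then obtain c where c: "of_F3 c = s" using of_F3_simps by metis
  have "of_F3 (Tr n x) = s"
    unfolding Tr_def s_def[symmetric]
    by (rule theI[of _ c]) (use c of_F3_inject[OF char3] in auto)
  then show ?thesis by (simp only: s_def)
qed

context
  fixes n :: nat
  assumes card: "CARD('a::{field,finite}) = 3 ^ n"
begin

lemma Tr_add: "Tr n (x + y :: 'a) = Tr n x + Tr n y"
proof (rule of_F3_inject)
  show char3: "(3::'a) = 0" by (rule char_3_if_card_power_3[OF card])
  show "of_F3 (Tr n (x + y)) = (of_F3 (Tr n x + Tr n y) :: 'a)"
    unfolding of_F3_add[OF char3] of_F3_Tr[OF card] frobenius_add[OF char3] by (rule sum.distrib)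
qed

lemma power_3_n: "x ^ (3 ^ n) = (x::'a)"
  using finite_field_power_card[of x] card by simp

lemma Tr_cube: "Tr n (x ^ 3 :: 'a) = Tr n x"
proof (rule of_F3_inject)
  show char3: "(3::'a) = 0" by (rule char_3_if_card_power_3[OF card])
  have "(\<Sum>i<n. (x ^ 3) ^ (3 ^ i)) + x ^ (3 ^ 0) = (\<Sum>i<n. x ^ (3 ^ i)) + x ^ (3 ^ n)"
    using sum.lessThan_Suc_shift[of "\<lambda>i. x ^ (3 ^ i)" n] by (simp add: add.commute power_mult)
  then show "of_F3 (Tr n (x ^ 3)) = (of_F3 (Tr n x) :: 'a)"
    unfolding of_F3_Tr[OF card] power_3_n by simp
qed

lemma Tr_frobenius: "Tr n (x ^ (3 ^ i) :: 'a) = Tr n x"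
proof (induction i arbitrary: x)
  case (Suc i)
  have "Tr n (x ^ (3 ^ Suc i)) = Tr n ((x ^ 3) ^ (3 ^ i))"
    by (simp only: power_Suc power_mult)
  then show ?case by (simp only: Suc Tr_cube)
qed simp

text \<open>The roots of a polynomial of degree at most \<open>3 ^ i\<close>. Positivity of
  \<open>i\<close> keeps its two monomials apart, so the leading coefficient is 1.\<close>

lemma card_additive_equation:
  assumes "i > 0"
  shows "card {x::'a. x ^ (3 ^ i) = c * x} \<le> 3 ^ i"
proof -
  define p where "p = monom (1::'a) (3 ^ i) - monom c 1"
  have "(3::nat) ^ i > 3 ^ 0" using assms by (intro power_strict_increasing) simp_all
  then have i: "(3::nat) ^ i > 1" by simp
  then have "coeff p (3 ^ i) = 1" by (simp add: p_def)
  then have "p \<noteq> 0" by auto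
  have "degree p \<le> 3 ^ i"
    unfolding p_def using i by (intro degree_diff_le order.trans[OF degree_monom_le]) simp_all
  moreover have "{x. x ^ (3 ^ i) = c * x} = {x. poly p x = 0}"
    by (simp add: p_def poly_monom)
  ultimately show ?thesis using card_poly_roots_bound[OF \<open>p \<noteq> 0\<close>] by simp
qed

text \<open>As a polynomial the trace is nonzero of degree at most \<open>3 ^ (n - 1)\<close>, too
  small to vanish everywhere.\<close>

lemma Tr_nondegenerate:
  assumes "x \<noteq> (0::'a)"
  shows "\<exists>y. Tr n (x * y) \<noteq> 0"
proof -
  have "card {0, 1 :: 'a} \<le> CARD('a)" by (rule card_mono) simp_all
  then have "n > 0" using card by (cases n) simp_all
  define p where "p = (\<Sum>i<n. monom (1::'a) (3 ^ i))"
  have "coeff p (3 ^ (n - 1)) = (\<Sum>i<n. if i = n - 1 then 1 else 0)"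
    unfolding p_def coeff_sum by (intro sum.cong) auto
  also have "\<dots> = 1" using \<open>n > 0\<close> by simp
  finally have "p \<noteq> 0" by auto
  have "degree p \<le> 3 ^ (n - 1)"
    unfolding p_def by (intro degree_sum_le) (auto intro!: order.trans[OF degree_monom_le] power_increasing)
  also have "\<dots> < 3 ^ n" using \<open>n > 0\<close> by simp
  finally have "card {x. poly p x = 0} < CARD('a)"
    using card_poly_roots_bound[OF \<open>p \<noteq> 0\<close>] card by simp
  then have "{x. poly p x = 0} \<noteq> UNIV" by auto
  then obtain z where "poly p z \<noteq> 0" by blast
  then have "of_F3 (Tr n z) \<noteq> (0::'a)"
    unfolding of_F3_Tr[OF card] by (simp add: p_def poly_sum poly_monom)
  then have "Tr n z \<noteq> 0" using of_F3_simps(1) by metis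
  moreover have "z = x * (z / x)" using assms by simp
  ultimately show ?thesis by metis
qed

end

text \<open>One exponent is 2 times an odd number, the other divisible by 4. Raised to a common
  exponent, one equation gives -1 and the other 1.\<close>

lemma minus_one_not_common_power:
  fixes g :: "'a::field"
  assumes "(3::'a) = 0" "g ^ (2 * (2 * b + 1)) = - 1" "g ^ (4 * a) = - 1"
  shows False
proof -
  have "(g ^ (2 * (2 * b + 1))) ^ (2 * a) = (g ^ (4 * a)) ^ (2 * b + 1)"
    unfolding power_mult[symmetric] by (rule arg_cong[where f = "\<lambda>i. g ^ i"]) simp
  then have "(- 1) ^ (2 * a) = (- 1 :: 'a) ^ (2 * b + 1)" unfolding assms(2,3) .
  then have "(1::'a) = - 1" by (simp add: power_mult)
  then have "(1::'a) + 1 = 0" by (metis add.right_inverse)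
  then show False using two_nonzero_char_3[OF assms(1)] by simp
qed

section \<open>Powers of three modulo four\<close>

lemma three_power_mod_4: "\<exists>a::nat. 3 ^ m = (if even m then 4 * a + 1 else 4 * a + 3)"
proof (induction m)
  case (Suc m)
  then obtain a where a: "3 ^ m = (if even m then 4 * a + 1 else 4 * a + (3::nat))" by blast
  show ?case
  proof (cases "even m")
    case True
    then show ?thesis using a by (intro exI[of _ "3 * a"]) simp
  next
    case False
    then show ?thesis using a by (intro exI[of _ "3 * a + 2"]) simp
  qed
qed simp

text \<open>For nonzero \<open>x\<close> the equations read \<open>x ^ (3 ^ m - 1) = - 1\<close> and
  \<open>x ^ (3 ^ l - 1) = - 1\<close>; the first exponent is divisible by 4, the second is 2 modulo
  4.\<close>

lemma no_common_anti_invariant: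
  fixes x :: "'a::field"
  assumes char3: "(3::'a) = 0" and "even m" "odd l" and x: "x ^ (3 ^ m) = - x" "x ^ (3 ^ l) = - x"
  shows "x = 0"
proof (rule ccontr)
  assume nz: "x \<noteq> 0"
  obtain a where a: "3 ^ m = 4 * a + (1::nat)" using three_power_mod_4[of m] \<open>even m\<close> by auto
  obtain b where b: "3 ^ l = 4 * b + (3::nat)" using three_power_mod_4[of l] \<open>odd l\<close> by auto
  have cancel: "y = - 1" if "x * y = - x" for y
    using that nz by (metis mult_cancel_left mult_minus1_right)
  have "3 ^ l = Suc (2 * (2 * b + 1))" using b by simp
  then have "x * x ^ (2 * (2 * b + 1)) = - x" using x(2) by (metis power_Suc)
  moreover have "x * x ^ (4 * a) = - x" using x(1) unfolding a by simp
  ultimately show False using minus_one_not_common_power[OF char3] cancel by blast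
qed

text \<open>The exponents are now \<open>3 ^ m + 1\<close> and \<open>3 ^ l + 1\<close>, so the
  residues 0 and 2 modulo 4 change places.\<close>

lemma no_common_norm_minus_one:
  fixes g :: "'a::field"
  assumes char3: "(3::'a) = 0" and "even m" "odd l" and g: "g * g ^ (3 ^ m) = - 1" "g * g ^ (3 ^ l) = - 1"
  shows False
proof -
  obtain a where a: "3 ^ m = 4 * a + (1::nat)" using three_power_mod_4[of m] \<open>even m\<close> by auto
  obtain b where b: "3 ^ l = 4 * b + (3::nat)" using three_power_mod_4[of l] \<open>odd l\<close> by auto
  have "Suc (3 ^ m) = 2 * (2 * a + 1)" "Suc (3 ^ l) = 4 * (b + 1)" using a b by simp_all
  then have "g ^ (2 * (2 * a + 1)) = - 1" "g ^ (4 * (b + 1)) = - 1"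
    using g by (metis power_Suc)+
  then show False using minus_one_not_common_power[OF char3] by blast
qed

lemma powi_uminus_odd:
  fixes x :: "'a::field"
  assumes "odd t"
  shows "(- x) powi t = - (x powi t)"
proof (cases "t \<ge> 0")
  case True
  then have "odd (nat t)" using assms by (simp add: even_nat_iff)
  then show ?thesis using True by (simp add: power_int_def)
next
  case False
  then have "odd (nat (- t))" using assms by (simp add: even_nat_iff)
  then show ?thesis using False by (simp add: power_int_def)
qed

text \<open>With \<open>h = (3 ^ k + 1) div 2\<close>, raising \<open>\<zeta> ^ h\<close> to the
  power \<open>3 ^ k - 1\<close> gives \<open>\<zeta>\<close> to half the order of the
  multiplicative group of the subfield, which is -1. The odd exponent \<open>t\<close> preserves the
  sign.\<close>

lemma anti_invariant_power_of_primitive: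
  fixes \<zeta> :: "'a::{field,finite}" and t :: int
  assumes card: "CARD('a) = 3 ^ (4 * k)" and "k \<ge> 1" and "odd t"
    and primitive: "primitive_element_of_subfield (3 ^ (2 * k)) \<zeta>"
  defines "\<alpha> \<equiv> \<zeta> powi (t * (3 ^ k + 1) div 2)"
  shows "\<alpha> \<noteq> 0" "\<alpha> ^ (3 ^ k) = - \<alpha>"
proof -
  note char3 = char_3_if_card_power_3[OF card]
  let ?K = "{x::'a. x ^ (3 ^ (2 * k)) = x}"
  let ?W = "{x::'a. x ^ (3 ^ (2 * k)) = - x}"
  have range: "range (\<lambda>i::nat. \<zeta> ^ i) = ?K - {0}"
    using primitive unfolding primitive_element_of_subfield_def .
  have "\<zeta> \<in> range (\<lambda>i::nat. \<zeta> ^ i)" by (metis power_one_right rangeI)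
  then have \<zeta>: "\<zeta> \<noteq> 0" "\<zeta> ^ (3 ^ (2 * k)) = \<zeta>" unfolding range by auto
  define \<tau> where "\<tau> x = x ^ (3 ^ (2 * k))" for x :: 'a
  have \<tau>_add: "\<tau> (x + y) = \<tau> x + \<tau> y" for x y
    unfolding \<tau>_def by (rule frobenius_add[OF char3])
  have \<tau>_\<tau>: "\<tau> (\<tau> x) = x" for x
  proof -
    have "\<tau> (\<tau> x) = x ^ (3 ^ (4 * k))"
      unfolding \<tau>_def power_mult[symmetric] power_add[symmetric] by simp
    then show ?thesis using power_3_n[OF card] by simp
  qed
  have \<tau>_diff: "\<tau> (x - y) = \<tau> x - \<tau> y" for x y
    using \<tau>_add[of x "- y"] by (simp add: \<tau>_def)
  \<comment> \<open>Splitting \<open>x\<close> into its parts fixed and negated by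
    \<open>\<tau>\<close>, together with the root bound for the negated part, bounds the size of the
    subfield from below.\<close>
  have "card (UNIV :: 'a set) \<le> card (?K \<times> ?W)"
  proof (rule card_inj_on_le)
    show "inj (\<lambda>x. (x + \<tau> x, x - \<tau> x))"
    proof (rule injI)
      fix x y assume eq: "(x + \<tau> x, x - \<tau> x) = (y + \<tau> y, y - \<tau> y)"
      then have "(x + \<tau> x) + (x - \<tau> x) = (y + \<tau> y) + (y - \<tau> y)" by simp
      then have "2 * x = 2 * y" by simp
      then show "x = y" using two_nonzero_char_3[OF char3] by simp
    qed
    show "range (\<lambda>x. (x + \<tau> x, x - \<tau> x)) \<subseteq> ?K \<times> ?W"
      unfolding \<tau>_def[symmetric] by (auto simp: \<tau>_add \<tau>_\<tau> \<tau>_diff)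
  qed simp
  then have "3 ^ (4 * k) \<le> card ?K * card ?W" by (simp add: card card_cartesian_product)
  also have "\<dots> \<le> card ?K * 3 ^ (2 * k)"
    using card_additive_equation[OF card, of "2 * k" "- 1"] \<open>k \<ge> 1\<close> by simp
  finally have "3 ^ (2 * k) * 3 ^ (2 * k) \<le> card ?K * 3 ^ (2 * k)"
    by (simp flip: power_add)
  then have card_K: "3 ^ (2 * k) \<le> card ?K" by simp
  define h :: nat where "h = (3 ^ k + 1) div 2"
  have h: "2 * h = 3 ^ k + 1" unfolding h_def by simp
  define m where "m = h * (3 ^ k - 1)"
  have "2 * m = (3 ^ k + 1) * (3 ^ k - 1)" unfolding m_def h[symmetric] by simp
  also have "\<dots> = 3 ^ (2 * k) - (1::nat)"
    unfolding mult_2 power_add by (simp add: algebra_simps)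
  finally have m: "2 * m = 3 ^ (2 * k) - (1::nat)" .
  have "(3::nat) ^ (2 * k) > 3 ^ 1" by (rule power_strict_increasing) (use \<open>k \<ge> 1\<close> in auto)
  then have "m > 0" using m by simp
  have "\<zeta> * \<zeta> ^ (2 * m) = \<zeta> * 1"
    using \<zeta>(2) unfolding m by (simp flip: power_Suc)
  then have "\<zeta> ^ (2 * m) = 1" using \<zeta>(1) mult_left_cancel by blast
  then have "\<zeta> ^ m * \<zeta> ^ m = 1" unfolding mult_2 power_add .
  then have "(\<zeta> ^ m - 1) * (\<zeta> ^ m + 1) = 0"
    by (simp add: algebra_simps)
  moreover have "\<zeta> ^ m \<noteq> 1"
  proof
    assume one: "\<zeta> ^ m = 1"
    \<comment> \<open>Otherwise \<open>\<zeta>\<close> would have at most \<open>m\<close> distinct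
      powers, while the subfield has at least \<open>2 * m\<close> nonzero elements.\<close>
    have "\<zeta> ^ i = \<zeta> ^ (i mod m)" for i
    proof -
      have "\<zeta> ^ i = \<zeta> ^ (m * (i div m) + i mod m)" by simp
      then show ?thesis unfolding power_add power_mult one by simp
    qed
    then have "range (\<lambda>i::nat. \<zeta> ^ i) \<subseteq> (\<lambda>i. \<zeta> ^ i) ` {..<m}"
      using \<open>m > 0\<close> by (metis (no_types, lifting) image_eqI image_subsetI lessThan_iff mod_less_divisor)
    then have "card (?K - {0}) \<le> card ((\<lambda>i. \<zeta> ^ i) ` {..<m})"
      unfolding range by (intro card_mono) simp_all
    also have "\<dots> \<le> m" using card_image_le[of "{..<m}"] by simp
    finally have "card ?K - 1 \<le> m" by (simp add: card_Diff_singleton zero_power)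
    then show False using card_K m \<open>m > 0\<close> by linarith
  qed
  ultimately have \<zeta>m: "\<zeta> ^ m = - 1" by (simp add: eq_neg_iff_add_eq_0)
  define \<eta> where "\<eta> = \<zeta> ^ h"
  have "t * (3 ^ k + 1) = 2 * (int h * t)"
    using arg_cong[OF h, of int] by (simp add: algebra_simps)
  then have "t * (3 ^ k + 1) div 2 = int h * t" by (simp only: nonzero_mult_div_cancel_left)
  then have \<alpha>: "\<alpha> = \<eta> powi t" by (simp only: \<alpha>_def \<eta>_def power_int_power)
  then show "\<alpha> \<noteq> 0" using \<zeta>(1) by (simp add: \<eta>_def)
  have "3 ^ k = (3 ^ k - 1) + (1::nat)" by simp
  then have "\<eta> ^ (3 ^ k) = \<eta> ^ (3 ^ k - 1) * \<eta>" by (metis power_add power_one_right)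
  also have "\<eta> ^ (3 ^ k - 1) = - 1" unfolding \<eta>_def power_mult[symmetric] m_def[symmetric] by (rule \<zeta>m)
  finally have \<eta>: "\<eta> ^ (3 ^ k) = - \<eta>" by simp
  have "\<alpha> ^ (3 ^ k) = (\<eta> ^ (3 ^ k)) powi t"
    unfolding \<alpha> power_int_power power_int_power' by (simp only: mult.commute)
  then show "\<alpha> ^ (3 ^ k) = - \<alpha>" unfolding \<eta> powi_uminus_odd[OF \<open>odd t\<close>] \<alpha> .
qed

theorem theorem5:
  fixes k n j :: nat and t :: int
    and \<zeta> :: "'a::{field,finite}"
    and f :: "'a \<Rightarrow> F3"
  assumes "k \<ge> 1" and "n = 4 * k"
    and "CARD('a) = 3 ^ n"
    and "CARD('p::finite) = 2 * k" and "CARD('q::finite) = k"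
    and "even k \<Longrightarrow> odd j" and "odd k \<Longrightarrow> even j"
    and "odd t"
    and "primitive_element_of_subfield (3 ^ (2 * k)) \<zeta>"
    and "f = (\<lambda>x. Tr n (x ^ (3 ^ k + 2) - x ^ (2 * 3 ^ k + 1)
                       + \<zeta> powi (t * (3 ^ k + 1) div 2) * x ^ (3 ^ j + 1)))"
  shows "cubic f \<and> bent (trace_form n) f \<and> \<not> weakly_regular (trace_form n) f \<and>
    (odd k \<and> j \<in> {0, 2 * k} \<longrightarrow>
      (\<exists>g :: F3 ^ 'q \<Rightarrow> F3 ^ 'p \<Rightarrow> F3.
         (\<forall>c. bent dot (g c)) \<and>
         EA_equivalent f (\<lambda>(x :: F3 ^ 'p, y1 :: F3 ^ 'q, y2 :: F3 ^ 'q). g y2 x + dot y1 y2)) \<and>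
      dual_bent (trace_form n) f)"
proof -
  note card = assms(3)
  note char3 = char_3_if_card_power_3[OF card]
  define \<alpha> where "\<alpha> = \<zeta> powi (t * (3 ^ k + 1) div 2)"
  define \<sigma> where "\<sigma> x = x ^ (3 ^ k)" for x :: 'a
  define \<rho> where "\<rho> x = x ^ (3 ^ j)" for x :: 'a
  \<comment> \<open>The exponents of 3 in \<open>\<rho>\<close> and \<open>\<rho>'\<close> add up to
    \<open>n * j\<close>, and the power \<open>3 ^ (n * j)\<close> acts as the identity.\<close>
  define \<rho>' where "\<rho>' x = x ^ (3 ^ ((n - 1) * j))" for x :: 'a
  have iterate: "(x ^ (3 ^ a)) ^ (3 ^ b) = x ^ (3 ^ (a + b))" for x :: 'a and a b :: nat
    by (simp only: power_mult[symmetric] power_add)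
  have periodic: "x ^ (3 ^ (n * i)) = x" for x :: 'a and i
    by (rule iterate_frobenius) (rule power_3_n[OF card])
  have \<alpha>: "\<alpha> \<noteq> 0" "\<sigma> \<alpha> = - \<alpha>"
    using anti_invariant_power_of_primitive[of k t \<zeta>] assms unfolding \<alpha>_def \<sigma>_def by auto
  have \<sigma>_\<sigma>: "\<sigma> (\<sigma> x) = x ^ (3 ^ (2 * k))" for x
    unfolding \<sigma>_def iterate by (simp only: mult_2)
  have nj: "j + (n - 1) * j = n * j"
  proof -
    have "Suc (n - 1) = n" using assms(1,2) by simp
    then show ?thesis by (metis mult_Suc)
  qed
  have card_E: "card {x. \<sigma> x = x} \<le> 3 ^ k" and card_W: "card {x. \<sigma> (\<sigma> x) = - x} \<le> 3 ^ (2 * k)"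
    and card_K: "card {x. \<sigma> (\<sigma> x) = x} \<le> 3 ^ (2 * k)"
    using card_additive_equation[OF card, of k 1] card_additive_equation[OF card, of "2 * k" 1]
      card_additive_equation[OF card, of "2 * k" "- 1"] assms(1)
    unfolding \<sigma>_\<sigma> by (simp_all add: \<sigma>_def)
  \<comment> \<open>By the root bound some \<open>x\<close> is not fixed by the square of
    \<open>\<sigma>\<close>; then \<open>x - \<sigma> (\<sigma> x)\<close> is a nonzero element of
    the desired kind.\<close>
  have W_nontrivial: "\<exists>w. w \<noteq> 0 \<and> \<sigma> (\<sigma> w) = - w"
  proof -
    have "(3::nat) ^ (2 * k) < 3 ^ n" using assms(1,2) by (intro power_strict_increasing) simp_all
    then have "card {x. \<sigma> (\<sigma> x) = x} < CARD('a)" unfolding card using card_K by (rule le_less_trans[rotated])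
    then have "{x. \<sigma> (\<sigma> x) = x} \<noteq> UNIV" by auto
    then obtain x where x: "\<sigma> (\<sigma> x) \<noteq> x" by blast
    have "\<sigma> (\<sigma> (x + - \<sigma> (\<sigma> x))) = \<sigma> (\<sigma> x) + \<sigma> (\<sigma> (- \<sigma> (\<sigma> x)))"
      unfolding \<sigma>_def frobenius_add[OF char3] ..
    also have "\<sigma> (\<sigma> (- \<sigma> (\<sigma> x))) = - x"
    proof -
      have "\<sigma> (\<sigma> (\<sigma> (\<sigma> x))) = x ^ (3 ^ n)"
        unfolding \<sigma>_def iterate by (rule arg_cong[where f = "\<lambda>i. x ^ (3 ^ i)"]) (simp add: assms(2))
      moreover have "\<sigma> (\<sigma> (- y)) = - \<sigma> (\<sigma> y)" for y by (simp add: \<sigma>_def)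
      ultimately show ?thesis using power_3_n[OF card] by simp
    qed
    finally have "\<sigma> (\<sigma> (x - \<sigma> (\<sigma> x))) = - (x - \<sigma> (\<sigma> x))" by simp
    then show ?thesis using x by (intro exI[of _ "x - \<sigma> (\<sigma> x)"]) simp
  qed
  interpret Q: quartic_setting \<sigma> \<rho> \<rho>' "Tr n" \<alpha>
  proof
    show "(3::'a) = 0" by (rule char3)
    show "\<sigma> (x + y) = \<sigma> x + \<sigma> y" "\<rho> (x + y) = \<rho> x + \<rho> y" for x y
      unfolding \<sigma>_def \<rho>_def by (rule frobenius_add[OF char3])+
    show "\<sigma> (x * y) = \<sigma> x * \<sigma> y" "\<rho> (x * y) = \<rho> x * \<rho> y" for x y
      unfolding \<sigma>_def \<rho>_def by (rule power_mult_distrib)+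
    show "\<sigma> (\<sigma> (\<sigma> (\<sigma> x))) = x" for x
    proof -
      have "\<sigma> (\<sigma> (\<sigma> (\<sigma> x))) = x ^ (3 ^ n)"
        unfolding \<sigma>_def iterate by (rule arg_cong[where f = "\<lambda>i. x ^ (3 ^ i)"]) (simp add: assms(2))
      then show ?thesis using power_3_n[OF card] by simp
    qed
    show "\<rho> (\<rho>' x) = x" "\<rho>' (\<rho> x) = x" for x
      unfolding \<rho>_def \<rho>'_def iterate nj add.commute[of _ j] by (rule periodic)+
    show "\<sigma> (\<rho> x) = \<rho> (\<sigma> x)" for x
      unfolding \<sigma>_def \<rho>_def iterate by (simp only: add.commute)
    show "Tr n (x + y) = Tr n x + Tr n y" for x y :: 'a by (rule Tr_add[OF card])
    show "Tr n (\<sigma> x) = Tr n x" "Tr n (\<rho> x) = Tr n x" for x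
      unfolding \<sigma>_def \<rho>_def by (rule Tr_frobenius[OF card])+
    show "\<exists>y. Tr n (x * y) \<noteq> 0" if "x \<noteq> 0" for x :: 'a by (rule Tr_nondegenerate[OF card that])
    show "\<alpha> \<noteq> 0" "\<sigma> \<alpha> = - \<alpha>" by (rule \<alpha>)+
    \<comment> \<open>The even one of \<open>j\<close> and \<open>k\<close> takes the role of
      \<open>m\<close>, the odd one that of \<open>l\<close>; likewise in the next
      condition.\<close>
    show "x = 0" if "\<sigma> x = - x" "\<rho> x = - x" for x
      using no_common_anti_invariant[OF char3] assms(6,7) that unfolding \<sigma>_def \<rho>_def by blast
    show "g * \<rho> g \<noteq> - 1" if "g * \<sigma> g = - 1" for g
      using no_common_norm_minus_one[OF char3] assms(6,7) that unfolding \<sigma>_def \<rho>_def by blast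
    show "\<exists>w. w \<noteq> 0 \<and> \<sigma> (\<sigma> w) = - w" by (rule W_nontrivial)
  qed
  have f: "f = Q.f"
  proof
    fix x
    have "x ^ (3 ^ k + 2) = x * x * \<sigma> x" "x ^ (2 * 3 ^ k + 1) = x * \<sigma> x * \<sigma> x" "x ^ (3 ^ j + 1) = x * \<rho> x"
      by (simp_all add: \<sigma>_def \<rho>_def power_add power2_eq_square mult_2 mult.commute mult.left_commute)
    then show "f x = Q.f x"
      unfolding assms(10) Q.f_def \<alpha>_def[symmetric] by (simp only: mult.assoc)
  qed
  have form: "trace_form n = Q.tr_form"
    by (intro ext) (simp only: trace_form_def Q.tr_form_def)
  \<comment> \<open>The root bounds give upper estimates. The splitting has exactly
    \<open>3 ^ (4 * k)\<close> elements in total, so both estimates are attained.\<close>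
  have "card Q.E = 3 ^ k \<and> card Q.W = 3 ^ (2 * k)"
  proof -
    let ?a = "card Q.E" and ?b = "card Q.W" and ?A = "3 ^ k :: nat" and ?B = "3 ^ (2 * k) :: nat"
    have le: "?a \<le> ?A" "?b \<le> ?B" using card_E card_W by (simp_all add: Q.E_def Q.W_def)
    have "?a * ?a * ?b = 3 ^ (k + k + 2 * k)"
      using Q.card_UNIV_eq card assms(2) by simp
    then have eq: "?a * ?a * ?b = ?A * ?A * ?B" by (simp only: power_add)
    have "?a = ?A"
    proof (rule ccontr)
      assume "?a \<noteq> ?A"
      then have "?a < ?A" using le by simp
      then have "?a * ?a < ?A * ?A" by (simp add: mult_strict_mono')
      then have "?a * ?a * ?B < ?A * ?A * ?B" by simp
      moreover have "?a * ?a * ?b \<le> ?a * ?a * ?B" using le(2) by (rule mult_le_mono2)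
      ultimately have "?a * ?a * ?b < ?A * ?A * ?B" by linarith
      with eq show False by simp
    qed
    with eq show ?thesis by simp
  qed
  then have cards: "card Q.E = 3 ^ CARD('q)" "card Q.W = 3 ^ CARD('p)"
    by (simp_all add: assms(4,5))
  show ?thesis
    unfolding f form
    using Q.cubic_f Q.bent_f Q.not_weakly_regular_f Q.EA_equivalent_f[OF cards] Q.dual_bent_f
    by (intro conjI impI)
qed

end
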